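(* Let $O,A,B$ be three pairwise distinct points of the Euclidean plane $\mathbb{R}^2$, let $\vec\alpha=\frac{1}{OA}\overrightarrow{AO}$, $\vec\beta=\frac{1}{OB}\overrightarrow{OB}$, let $\Omega\in]-\pi,\pi]$ be the principal determination of the oriented angle from $\vec\alpha$ to $\vec\beta$, and assume $\Omega\in]0,\pi[$. Let $\mathcal{E}$ be the set of curves with nonnegative signed curvature joining $A$ to $B$ with unit tangents $\vec\alpha$ at $A$ and $\vec\beta$ at $B$ (defined precisely in the context), and let $\mathcal{J}(O,A,B)\in\mathcal{E}$ be the unique curve of $\mathcal{E}$ formed of a circular arc and a line segment (possibly reduced to a point) (defined precisely in the context). Then $\mathcal{J}(O,A,B)$ is the unique curve $X\in\mathcal{E}$ which minimizes the maximum of the curvature, i.e. the unique $X\in\mathcal{E}$ such that $$\big\|\,\|X''\|\,\big\|_{L^\infty(0,L(X))}=\min_{Z\in\mathcal{E}}\big\|\,\|Z''\|\,\big\|_{L^\infty(0,L(Z))}.$$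
   Context: $\|\cdot\|$ is the Euclidean norm of $\mathbb{R}^2$. Let $\vec k$ be the unit vector obtained by rotating $\vec\alpha$ by $+\pi/2$. Definition of $\mathcal{E}$: the set of all curves $X:[0,L]\to\mathbb{R}^2$, with $L=L(X)>0$ depending on $X$, such that $X\in W^{2,\infty}(0,L;\mathbb{R}^2)$ (hence $X$ is $C^1$ on $[0,L]$), $\|X'(s)\|=1$ for all $s\in[0,L]$, $X(0)=A$, $X(L)=B$, $X'(0)=\vec\alpha$, $X'(L)=\vec\beta$, and such that the angle $\phi$ is nondecreasing on $[0,L]$. Here $\phi:[0,L]\to\mathbb{R}$ is the continuous determination of the oriented angle from $\vec\alpha$ to $X'(s)$, i.e. $X'(s)=\cos\phi(s)\,\vec\alpha+\sin\phi(s)\,\vec k$; equalities of angles are understood strictly and not modulo $2\pi$, so that $\phi(0)=0$, $\phi(L)=\Omega$ and hence $\phi(s)\in[0,\Omega]$ for all $s$. Monotonicity of $\phi$ is equivalent to the signed curvature $c=\phi'$ being nonnegative almost everywhere, and then $c(s)=\|X''(s)\|$ for a.e. $s$. Definition of $\mathcal{J}(O,A,B)$: if $OA=OB$ (symmetric case), it is the unique curve of $\mathcal{E}$ consisting of one circular arc of some radius $R_a>0$ and of length in $]0,R_a\pi[$; if $OA\neq OB$ (non-symmetric case), it is the unique curve of $\mathcal{E}$ consisting of one circular arc of some radius $R_a>0$ and of length in $]0,R_a\pi[$, together with one line segment of nonzero length (in either order). Such a curve exists and is unique. *)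

theory Defs
  imports "HOL-Analysis.Analysis" "HOL-Probability.Essential_Supremum"
begin

section \<open>The spaces \<open>L\<^sup>\<infinity>\<close> and \<open>W\<^sup>2\<^sup>,\<^sup>\<infinity>\<close> on an open interval\<close>

definition Linf_on :: "real set \<Rightarrow> (real \<Rightarrow> 'a::euclidean_space) \<Rightarrow> bool" where
  "Linf_on I f \<longleftrightarrow>
     f \<in> borel_measurable (lebesgue_on I) \<and> (\<exists>C. AE s in lebesgue_on I. norm (f s) \<le> C)"

definition Linf_norm :: "real set \<Rightarrow> (real \<Rightarrow> 'a::euclidean_space) \<Rightarrow> ereal" where
  "Linf_norm I f = esssup (lebesgue_on I) (\<lambda>s. ereal (norm (f s)))"

text \<open>Weak derivatives on an interval are taken against compactly supported \<open>C\<^sup>1\<close> test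
  functions, as in Brezis, Functional Analysis, Sobolev Spaces and PDE, Chapter 8.\<close>

definition test_function :: "real set \<Rightarrow> (real \<Rightarrow> real) \<Rightarrow> bool" where
  "test_function I \<psi> \<longleftrightarrow>
     \<psi> C1_differentiable_on UNIV \<and>
     compact (closure {s. \<psi> s \<noteq> 0}) \<and> closure {s. \<psi> s \<noteq> 0} \<subseteq> I"

definition is_weak_deriv ::
    "real set \<Rightarrow> (real \<Rightarrow> 'a::euclidean_space) \<Rightarrow> (real \<Rightarrow> 'a) \<Rightarrow> bool" where
  "is_weak_deriv I u g \<longleftrightarrow>
     (\<forall>\<psi>. test_function I \<psi> \<longrightarrow>
        (\<integral>s. deriv \<psi> s *\<^sub>R u s \<partial>lebesgue_on I) = - (\<integral>s. \<psi> s *\<^sub>R g s \<partial>lebesgue_on I))"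

definition W1inf :: "real set \<Rightarrow> (real \<Rightarrow> 'a::euclidean_space) \<Rightarrow> bool" where
  "W1inf I u \<longleftrightarrow> Linf_on I u \<and> (\<exists>g. Linf_on I g \<and> is_weak_deriv I u g)"

text \<open>The weak derivative is determined only up to a null set; any choice serves.\<close>

definition weak_deriv :: "real set \<Rightarrow> (real \<Rightarrow> 'a::euclidean_space) \<Rightarrow> real \<Rightarrow> 'a" where
  "weak_deriv I u = (SOME g. Linf_on I g \<and> is_weak_deriv I u g)"

definition W2inf :: "real set \<Rightarrow> (real \<Rightarrow> 'a::euclidean_space) \<Rightarrow> bool" where
  "W2inf I u \<longleftrightarrow> W1inf I u \<and> W1inf I (weak_deriv I u)"

section \<open>Oriented angles\<close>

definition rot90 :: "real^2 \<Rightarrow> real^2" where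
  "rot90 v = vector [- v$2, v$1]"

text \<open>Principal determination of the oriented angle between two unit vectors.\<close>

definition oriented_angle :: "real^2 \<Rightarrow> real^2 \<Rightarrow> real" where
  "oriented_angle u v =
     (THE \<omega>. - pi < \<omega> \<and> \<omega> \<le> pi \<and> v = cos \<omega> *\<^sub>R u + sin \<omega> *\<^sub>R rot90 u)"

text \<open>The point written \<open>O\<close> in the mathematics is called \<open>P\<close>, since \<open>O\<close> is reserved
  syntax for relation composition.\<close>

definition alpha :: "real^2 \<Rightarrow> real^2 \<Rightarrow> real^2" where
  "alpha P A = (1 / dist P A) *\<^sub>R (P - A)"

definition beta :: "real^2 \<Rightarrow> real^2 \<Rightarrow> real^2" where
  "beta P B = (1 / dist P B) *\<^sub>R (B - P)"

definition Omega :: "real^2 \<Rightarrow> real^2 \<Rightarrow> real^2 \<Rightarrow> real" where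
  "Omega P A B = oriented_angle (alpha P A) (beta P B)"

section \<open>The admissible curves\<close>

text \<open>A curve \<open>X : [0,L] \<rightarrow> \<real>\<^sup>2\<close> is the pair \<open>(L, X)\<close> with \<open>X\<close> extensional on \<open>[0,L]\<close>, so
  that equality of pairs is equality of curves.\<close>

type_synonym curve = "real \<times> (real \<Rightarrow> real^2)"

definition tangent :: "curve \<Rightarrow> real \<Rightarrow> real^2" where
  "tangent c s = vector_derivative (snd c) (at s within {0..fst c})"

text \<open>The conditions on differentiability and continuity of the tangent select the \<open>C\<^sup>1\<close>
  representative of the Sobolev class.\<close>

definition curves :: "real^2 \<Rightarrow> real^2 \<Rightarrow> real^2 \<Rightarrow> curve set" where
  "curves P A B = {(L, X).
     0 < L \<and> X \<in> extensional {0..L} \<and> W2inf {0<..<L} X \<and>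
     (\<forall>s\<in>{0..L}. X differentiable (at s within {0..L})) \<and>
     continuous_on {0..L} (tangent (L, X)) \<and>
     (\<forall>s\<in>{0..L}. norm (tangent (L, X) s) = 1) \<and>
     X 0 = A \<and> X L = B \<and>
     tangent (L, X) 0 = alpha P A \<and> tangent (L, X) L = beta P B \<and>
     (\<exists>\<phi>. continuous_on {0..L} \<phi> \<and> \<phi> 0 = 0 \<and> \<phi> L = Omega P A B \<and>
        (\<forall>s\<in>{0..L}. tangent (L, X) s =
            cos (\<phi> s) *\<^sub>R alpha P A + sin (\<phi> s) *\<^sub>R rot90 (alpha P A)) \<and>
        mono_on {0..L} \<phi>)}"

definition max_curvature :: "curve \<Rightarrow> ereal" where
  "max_curvature c =
     Linf_norm {0<..<fst c} (weak_deriv {0<..<fst c} (weak_deriv {0<..<fst c} (snd c)))"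

section \<open>The curve made of an arc and a segment\<close>

text \<open>The two predicates below describe arclength parametrizations; \<open>\<epsilon>\<close> is the direction in
  which the circle is traversed.\<close>

definition arc_on :: "real \<Rightarrow> real \<Rightarrow> real \<Rightarrow> (real \<Rightarrow> real^2) \<Rightarrow> bool" where
  "arc_on R a b X \<longleftrightarrow>
     (\<exists>p \<theta> \<epsilon>. \<epsilon> \<in> {1, -1} \<and>
        (\<forall>s\<in>{a..b}. X s = p + R *\<^sub>R vector [cos (\<theta> + \<epsilon> * (s - a) / R),
                                             sin (\<theta> + \<epsilon> * (s - a) / R)]))"

definition segment_on :: "real \<Rightarrow> real \<Rightarrow> (real \<Rightarrow> real^2) \<Rightarrow> bool" where
  "segment_on a b X \<longleftrightarrow>
     (\<exists>p u. norm u = 1 \<and> (\<forall>s\<in>{a..b}. X s = p + (s - a) *\<^sub>R u))"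

definition is_single_arc :: "curve \<Rightarrow> bool" where
  "is_single_arc c \<longleftrightarrow>
     (\<exists>R>0. 0 < fst c \<and> fst c < R * pi \<and> arc_on R 0 (fst c) (snd c))"

definition is_arc_and_segment :: "curve \<Rightarrow> bool" where
  "is_arc_and_segment c \<longleftrightarrow>
     (\<exists>R>0. \<exists>m. 0 < m \<and> m < fst c \<and>
        (m < R * pi \<and> arc_on R 0 m (snd c) \<and> segment_on m (fst c) (snd c) \<or>
         fst c - m < R * pi \<and> segment_on 0 m (snd c) \<and> arc_on R m (fst c) (snd c)))"

definition is_J :: "real^2 \<Rightarrow> real^2 \<Rightarrow> real^2 \<Rightarrow> curve \<Rightarrow> bool" where
  "is_J P A B c \<longleftrightarrow>
     c \<in> curves P A B \<and>
     (if dist P A = dist P B then is_single_arc c else is_arc_and_segment c)"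

definition J :: "real^2 \<Rightarrow> real^2 \<Rightarrow> real^2 \<Rightarrow> curve" where
  "J P A B = (THE c. is_J P A B c)"

end

theory Submission
  imports Defs
begin

text \<open>
  Write \<open>a = PA\<close>, \<open>b = PB\<close>, and let \<open>\<phi>\<close>, nondecreasing from \<open>0\<close> to \<open>\<Omega>\<close>, be the tangent angle of a
  curve of the class. Projecting the displacement \<open>B - A = a \<alpha> + b \<beta>\<close> on the normals of
  \<open>\<alpha>\<close> and of \<open>\<beta>\<close> shows that the integral of \<open>sin \<phi>\<close> is \<open>b sin \<Omega>\<close> and that of
  \<open>sin (\<Omega> - \<phi>)\<close> is \<open>a sin \<Omega>\<close> (\<open>angle_integrals\<close>). If the curvature is at most \<open>1/R\<close>,
  then \<open>\<phi>\<close> is \<open>1/R\<close>-Lipschitz, so that \<open>sin \<phi> \<ge> R \<phi>' sin \<phi>\<close> and the first integral is at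
  least \<open>R (1 - cos \<Omega>)\<close>; by symmetry so is the second one. Hence
  \<open>R (1 - cos \<Omega>) \<le> min a b sin \<Omega>\<close>. If equality holds, say with \<open>b \<le> a\<close>, then \<open>\<phi>' = 1/R\<close>
  wherever \<open>\<phi> > 0\<close>: the curve is a segment followed by an arc of radius \<open>R\<close>
  (\<open>segment_arc_rigidity\<close>; its mirror image \<open>arc_segment_rigidity\<close> serves for \<open>a \<le> b\<close>).

  The two integrals also determine the lengths of the pieces of any curve made of an arc and a
  segment, so there is only one such curve (\<open>profile_curve_unique\<close>,
  \<open>arc_and_segment_imp_arcseg\<close>). It is written down explicitly as \<open>arcseg\<close>; its curvature is at
  most \<open>1/R\<close> for the extremal \<open>R\<close>, and every curve with this bound coincides with it
  (\<open>small_curvature_imp_arcseg\<close>), which gives both minimality and uniqueness.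

  The Lipschitz bound on \<open>\<phi>\<close> is read off from the weak second derivative: a weak derivative is
  unique almost everywhere (\<open>weak_deriv_unique\<close>), so the weak first derivative is the continuous
  tangent, and a continuous function whose weak derivative is bounded by \<open>K\<close> is \<open>K\<close>-Lipschitz
  (\<open>weak_deriv_bound_imp_lipschitz\<close>). The rest of the lower bound needs no almost everywhere
  argument: inequalities that hold for the derivative are replaced by inequalities for increments with a
  quadratic error, which subdivision removes (\<open>nondecreasing_if_quadratic_defect\<close>).
\<close>

section \<open>Bounded measurable functions\<close>

lemma Linf_on_integrable:
  fixes f :: "real \<Rightarrow> 'a::euclidean_space"
  assumes "Linf_on {a<..<b} f"
  shows "integrable (lebesgue_on {a<..<b}) f"
proof -
  interpret finite_measure "lebesgue_on {a<..<b}"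
    by (rule finite_measure_lebesgue_on) (simp add: bounded_set_imp_lmeasurable)
  obtain C where C: "AE s in lebesgue_on {a<..<b}. norm (f s) \<le> C"
    using assms unfolding Linf_on_def by blast
  show ?thesis
    by (rule integrable_const_bound[OF C]) (use assms in \<open>auto simp: Linf_on_def\<close>)
qed

lemma Linf_on_continuous:
  fixes f :: "real \<Rightarrow> 'a::euclidean_space"
  assumes "continuous_on {a..b} f"
  shows "Linf_on {a<..<b} f"
  unfolding Linf_on_def
proof
  show "f \<in> borel_measurable (lebesgue_on {a<..<b})"
    by (rule continuous_imp_measurable_on_sets_lebesgue)
       (auto intro!: continuous_on_subset[OF assms])
  have "bounded (f ` {a..b})"
    by (intro compact_imp_bounded compact_continuous_image assms) auto
  then obtain C where "\<forall>x\<in>{a..b}. norm (f x) \<le> C" by (auto simp: bounded_iff)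
  then show "\<exists>C. AE s in lebesgue_on {a<..<b}. norm (f s) \<le> C"
    by (intro exI[of _ C] AE_I2) auto
qed

lemma Linf_on_scaleR:
  fixes f :: "real \<Rightarrow> 'a::euclidean_space" and p :: "real \<Rightarrow> real"
  assumes "Linf_on I p" "Linf_on I f"
  shows "Linf_on I (\<lambda>s. p s *\<^sub>R f s)"
proof -
  obtain C D where C: "AE s in lebesgue_on I. norm (p s) \<le> C"
    and D: "AE s in lebesgue_on I. norm (f s) \<le> D"
    using assms unfolding Linf_on_def by blast
  have "AE s in lebesgue_on I. norm (p s *\<^sub>R f s) \<le> \<bar>C\<bar> * \<bar>D\<bar>"
    using C D by eventually_elim (auto intro!: mult_mono)
  with assms show ?thesis
    unfolding Linf_on_def by (intro conjI exI borel_measurable_scaleR) auto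
qed

lemma Linf_on_diff:
  fixes f g :: "real \<Rightarrow> 'a::euclidean_space"
  assumes "Linf_on I f" "Linf_on I g"
  shows "Linf_on I (\<lambda>s. f s - g s)"
proof -
  obtain C D where C: "AE s in lebesgue_on I. norm (f s) \<le> C"
    and D: "AE s in lebesgue_on I. norm (g s) \<le> D"
    using assms unfolding Linf_on_def by blast
  have "AE s in lebesgue_on I. norm (f s - g s) \<le> C + D"
    using C D by eventually_elim (smt (verit) norm_triangle_ineq4)
  with assms show ?thesis
    unfolding Linf_on_def by (intro conjI exI borel_measurable_diff) auto
qed

lemma integral_lebesgue_on_open_interval:
  fixes f :: "real \<Rightarrow> 'a::euclidean_space"
  assumes "integrable (lebesgue_on {a<..<b}) f"
  shows "(\<integral>s. f s \<partial>lebesgue_on {a<..<b}) = integral {a..b} f"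
proof -
  have "(f has_integral (\<integral>s. f s \<partial>lebesgue_on {a<..<b})) {a<..<b}"
    using has_integral_integral_lebesgue_on[OF assms] by simp
  then have "(f has_integral (\<integral>s. f s \<partial>lebesgue_on {a<..<b})) {a..b}"
    by (simp add: has_integral_Icc_iff_Ioo)
  then show ?thesis by (simp add: integral_unique)
qed

section \<open>Test functions\<close>

text \<open>The positive part. Its square is continuously differentiable, so quadratic splines built from
  translates of it are \<open>C\<^sup>1\<close> without any matching conditions.\<close>

definition hinge :: "real \<Rightarrow> real" where
  "hinge x = max 0 x"

lemma hinge_sq_deriv: "((\<lambda>x. (hinge x)\<^sup>2) has_field_derivative 2 * hinge x) (at x)"
proof (cases x "0::real" rule: linorder_cases)
  case less
  have "((\<lambda>x. (hinge x)\<^sup>2) has_field_derivative 0) (at x)"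
    by (rule has_field_derivative_transform_within_open[of "\<lambda>x. 0" _ _ "{..<0}"])
       (use less in \<open>auto simp: hinge_def\<close>)
  with less show ?thesis by (simp add: hinge_def)
next
  case greater
  have "((\<lambda>x. (hinge x)\<^sup>2) has_field_derivative 2 * x) (at x)"
    by (rule has_field_derivative_transform_within_open[of "\<lambda>x. x\<^sup>2" _ _ "{0<..}"])
       (use greater in \<open>auto simp: hinge_def intro!: derivative_eq_intros\<close>)
  with greater show ?thesis by (simp add: hinge_def)
next
  case equal
  have "((\<lambda>y. (hinge y)\<^sup>2 / y) \<longlongrightarrow> 0) (at 0)"
  proof (rule Lim_null_comparison)
    show "eventually (\<lambda>y. norm ((hinge y)\<^sup>2 / y) \<le> \<bar>y\<bar>) (at 0)"
      by (intro always_eventually allI) (auto simp: hinge_def max_def power2_eq_square)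
    show "((\<lambda>y::real. \<bar>y\<bar>) \<longlongrightarrow> 0) (at 0)"
      by (auto intro!: tendsto_eq_intros)
  qed
  then show ?thesis using equal by (simp add: has_field_derivative_iff hinge_def)
qed

text \<open>A \<open>C\<^sup>1\<close> step from \<open>0\<close> on \<open>{..0}\<close> to \<open>1\<close> on \<open>{1..}\<close>. Its derivative \<open>step'\<close> is the tent function
  on \<open>{0..1}\<close> of height \<open>2\<close>.\<close>

definition step :: "real \<Rightarrow> real" where
  "step x = 2 * (hinge x)\<^sup>2 - 4 * (hinge (x - 1/2))\<^sup>2 + 2 * (hinge (x - 1))\<^sup>2"

definition step' :: "real \<Rightarrow> real" where
  "step' x = 4 * hinge x - 8 * hinge (x - 1/2) + 4 * hinge (x - 1)"

lemma step_deriv: "(step has_field_derivative step' x) (at x)"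
  unfolding step_def step'_def
  by (rule derivative_eq_intros DERIV_chain2[OF hinge_sq_deriv] refl | simp)+

lemma step'_cont [continuous_intros]:
  "continuous_on S f \<Longrightarrow> continuous_on S (\<lambda>x. step' (f x))"
  unfolding step'_def hinge_def by (intro continuous_intros)

lemma step_0: "x \<le> 0 \<Longrightarrow> step x = 0" and step_1: "x \<ge> 1 \<Longrightarrow> step x = 1"
  by (auto simp: step_def hinge_def max_def power2_eq_square algebra_simps)

lemma step'_nonneg: "step' x \<ge> 0"
  and step'_outside: "x \<notin> {0<..<1} \<Longrightarrow> step' x = 0"
  by (auto simp: step'_def hinge_def max_def)

lemma step_mono: "x \<le> y \<Longrightarrow> step x \<le> step y"
  by (rule DERIV_nonneg_imp_nondecreasing) (use step_deriv step'_nonneg in blast)+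

lemma step_bounds: "0 \<le> step x" "step x \<le> 1"
  using step_mono[of "min x 0" x] step_mono[of x "max x 1"] step_0[of "min x 0"] step_1[of "max x 1"]
  by auto

text \<open>A test function that vanishes outside \<open>{p..q}\<close>, rises to \<open>1\<close> on \<open>{p..p + e}\<close> and falls on
  \<open>{q - e..q}\<close>.\<close>

definition plateau :: "real \<Rightarrow> real \<Rightarrow> real \<Rightarrow> real \<Rightarrow> real" where
  "plateau p q e x = step ((x - p) / e) - step ((x - (q - e)) / e)"

lemma plateau_deriv:
  assumes "e > 0"
  shows "(plateau p q e has_field_derivative
           (step' ((x - p) / e) - step' ((x - (q - e)) / e)) / e) (at x)"
proof -
  have "((\<lambda>x. step ((x - c) / e)) has_field_derivative step' ((x - c) / e) * (1 / e)) (at x)" for c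
    by (rule DERIV_chain2[OF step_deriv]) (use assms in \<open>auto intro!: derivative_eq_intros\<close>)
  from DERIV_diff[OF this[of p] this[of "q - e"]] show ?thesis
    unfolding plateau_def by (simp add: diff_divide_distrib)
qed

lemma deriv_plateau:
  "e > 0 \<Longrightarrow> deriv (plateau p q e) = (\<lambda>x. (step' ((x - p) / e) - step' ((x - (q - e)) / e)) / e)"
  using DERIV_imp_deriv[OF plateau_deriv] by blast

lemma plateau_bounds:
  assumes "e > 0" "p + e \<le> q"
  shows "0 \<le> plateau p q e x" "plateau p q e x \<le> 1"
    "x \<notin> {p..q} \<Longrightarrow> plateau p q e x = 0"
    "p + e \<le> x \<Longrightarrow> x \<le> q - e \<Longrightarrow> plateau p q e x = 1"
proof -
  have "step ((x - (q - e)) / e) \<le> step ((x - p) / e)"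
    using assms by (intro step_mono divide_right_mono) auto
  then show "0 \<le> plateau p q e x" by (simp add: plateau_def)
  show "plateau p q e x \<le> 1"
    unfolding plateau_def using step_bounds[of "(x - p) / e"] step_bounds[of "(x - (q - e)) / e"] by linarith
  show "plateau p q e x = 0" if "x \<notin> {p..q}"
  proof (cases "x < p")
    case True
    then show ?thesis
      using assms by (simp add: plateau_def step_0 divide_le_0_iff)
  next
    case False
    then have "x > q" using that by auto
    then show ?thesis
      using assms by (simp add: plateau_def step_1)
  qed
  show "plateau p q e x = 1" if "p + e \<le> x" "x \<le> q - e"
    using assms that by (simp add: plateau_def step_0 step_1 divide_le_0_iff)
qed

lemma test_function_plateau:
  assumes "e > 0" "p + e \<le> q" "a < p" "q < b"
  shows "test_function {a<..<b} (plateau p q e)"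
proof -
  have "closure {s. plateau p q e s \<noteq> 0} \<subseteq> {p..q}"
    
    by (intro closure_minimal subsetI) (use plateau_bounds(3)[OF assms(1,2)] in blast, simp)
  moreover have "plateau p q e C1_differentiable_on UNIV"
    unfolding C1_differentiable_on_def
  proof (intro exI conjI ballI)
    show "(plateau p q e has_vector_derivative
            (step' ((x - p) / e) - step' ((x - (q - e)) / e)) / e) (at x)" for x
      using plateau_deriv[OF assms(1)] by (simp add: has_real_derivative_iff_has_vector_derivative)
  qed (intro continuous_intros, use assms in auto)
  ultimately show ?thesis
    unfolding test_function_def using assms
    by (auto simp: compact_eq_bounded_closed intro: bounded_subset[OF bounded_closed_interval])
qed

lemma test_function_continuous:
  assumes "test_function I p"
  shows "continuous_on S p" "continuous_on S (deriv p)"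
    "(p has_field_derivative deriv p x) (at x)" "x \<notin> I \<Longrightarrow> p x = 0"
proof -
  have *: "p differentiable at x" "continuous_on UNIV (\<lambda>x. vector_derivative p (at x))" for x
    using assms by (auto simp: test_function_def C1_differentiable_on_eq)
  have d: "(p has_field_derivative deriv p x) (at x)" for x
    using *(1) by (simp add: DERIV_deriv_iff_real_differentiable)
  then show "(p has_field_derivative deriv p x) (at x)" .
  have "vector_derivative p (at x) = deriv p x" for x
    using d by (simp add: has_real_derivative_iff_has_vector_derivative vector_derivative_at)
  with *(2) have "continuous_on UNIV (deriv p)" by simp
  then show "continuous_on S (deriv p)" by (rule continuous_on_subset) auto
  show "continuous_on S p"
    using *(1) by (auto intro!: continuous_at_imp_continuous_on differentiable_imp_continuous_within)
  show "p x = 0" if "x \<notin> I"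
    using assms that closure_subset[of "{s. p s \<noteq> 0}"] by (auto simp: test_function_def)
qed

section \<open>Weak derivatives\<close>

text \<open>The fundamental lemma of the calculus of variations. Plateaus approximate indicators, so the
  integral of \<open>h\<close> over every subinterval vanishes, and the Lebesgue differentiation theorem applies.\<close>

lemma fundamental_lemma_variations:
  fixes h :: "real \<Rightarrow> 'a::euclidean_space"
  assumes h: "integrable (lebesgue_on {a<..<b}) h"
    and zero: "\<And>p. test_function {a<..<b} p \<Longrightarrow> (\<integral>s. p s *\<^sub>R h s \<partial>lebesgue_on {a<..<b}) = 0"
  shows "AE s in lebesgue_on {a<..<b}. h s = 0"
proof -
  let ?M = "lebesgue_on {a<..<b}"
  have int0: "integral {s..t} h = 0" if st: "a < s" "s < t" "t < b" for s t
  proof -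
    define e where "e n = (t - s) * inverse (real (Suc n))" for n
    have "inverse (real (Suc n)) \<le> 1" for n by (simp add: field_simps)
    then have "(t - s) * inverse (real (Suc n)) \<le> t - s" for n
      using st by (intro mult_left_le) auto
    then have "e n \<le> t - s" for n by (simp only: e_def)
    then have e2: "s + e n \<le> t" for n by (simp only: le_diff_eq add.commute)
    have e1: "e n > 0" for n using st by (simp add: e_def)
    note e = e1 e2
    have elim: "e \<longlonglongrightarrow> 0"
      unfolding e_def by (rule tendsto_mult_right_zero[OF LIMSEQ_inverse_real_of_nat])
    have meas: "(\<lambda>x. indicat_real {s<..<t} x *\<^sub>R h x) \<in> borel_measurable ?M"
      by (intro borel_measurable_scaleR borel_measurable_integrable[OF h] measurable_restrict_space1
            measurable_completion borel_measurable_indicator) auto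
    have "(\<lambda>n. \<integral>x. plateau s t (e n) x *\<^sub>R h x \<partial>?M) \<longlonglongrightarrow> (\<integral>x. indicat_real {s<..<t} x *\<^sub>R h x \<partial>?M)"
    proof (rule integral_dominated_convergence)
      show "integrable ?M (\<lambda>x. norm (h x))" using h by simp
      show "(\<lambda>x. indicat_real {s<..<t} x *\<^sub>R h x) \<in> borel_measurable ?M" by (rule meas)
      show "(\<lambda>x. plateau s t (e n) x *\<^sub>R h x) \<in> borel_measurable ?M" for n
        by (intro borel_measurable_scaleR borel_measurable_integrable[OF h]
             continuous_imp_measurable_on_sets_lebesgue
             test_function_continuous(1)[OF test_function_plateau[OF e st(1,3)]]) auto
      show "AE x in ?M. norm (plateau s t (e n) x *\<^sub>R h x) \<le> norm (h x)" for n
        using plateau_bounds(1,2)[OF e] by (intro AE_I2) (auto intro!: mult_left_le_one_le)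
      show "AE x in ?M. (\<lambda>n. plateau s t (e n) x *\<^sub>R h x) \<longlonglongrightarrow> indicat_real {s<..<t} x *\<^sub>R h x"
      proof (rule AE_I2)
        fix x
        have ev: "eventually (\<lambda>n. plateau s t (e n) x = indicat_real {s<..<t} x) sequentially"
        proof (cases "x \<in> {s<..<t}")
          case True
          then have "eventually (\<lambda>n. e n < min (x - s) (t - x)) sequentially"
            by (intro order_tendstoD(2)[OF elim]) auto
          then show ?thesis
            by eventually_elim (use True plateau_bounds(4)[OF e] in auto)
        next
          case False
          have "plateau s t (e n) x = 0" for n
          proof (cases "x \<in> {s..t}")
            case True
            with False have "x = s \<or> x = t" by auto
            then show ?thesis
              using e[of n] by (auto simp: plateau_def step_0 step_1 divide_le_0_iff)
          qed (use plateau_bounds(3)[OF e] in auto)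
          with False show ?thesis by simp
        qed
        show "(\<lambda>n. plateau s t (e n) x *\<^sub>R h x) \<longlonglongrightarrow> indicat_real {s<..<t} x *\<^sub>R h x"
          by (rule tendsto_eventually) (use ev in eventually_elim, simp)
      qed
    qed
    moreover have "(\<integral>x. plateau s t (e n) x *\<^sub>R h x \<partial>?M) = 0" for n
      by (rule zero[OF test_function_plateau[OF e st(1,3)]])
    ultimately have "(\<integral>x. indicat_real {s<..<t} x *\<^sub>R h x \<partial>?M) = 0"
      by (simp add: LIMSEQ_const_iff)
    moreover have "integrable ?M (\<lambda>x. indicat_real {s<..<t} x *\<^sub>R h x)"
      by (rule Bochner_Integration.integrable_bound[OF h meas]) (auto intro!: AE_I2 simp: indicator_def)
    ultimately have "integral {a..b} (\<lambda>x. indicat_real {s<..<t} x *\<^sub>R h x) = 0"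
      using integral_lebesgue_on_open_interval by metis
    also have "(\<lambda>x. indicat_real {s<..<t} x *\<^sub>R h x) = (\<lambda>x. if x \<in> {s<..<t} then h x else 0)"
      by (auto simp: indicator_def)
    also have "integral {a..b} \<dots> = integral {s<..<t} h"
    proof -
      have "{a..b} \<inter> {s<..<t} = {s<..<t}" using st by auto
      with integral_restrict_Int[of "{a..b}" "{s<..<t}" h] show ?thesis by (simp only: Int_commute)
    qed
    also have "\<dots> = integral {s..t} h"
      by (simp add: integral_open_interval_real)
    finally show ?thesis .
  qed
  define f where "f x = (if x \<in> {a<..<b} then h x else 0)" for x
  have "f integrable_on UNIV"
    unfolding f_def using integrable_on_lebesgue_on[OF h] by (subst integrable_restrict_UNIV) auto
  then have "f integrable_on cbox u v" for u v
    by (rule integrable_on_subcbox) auto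
  then obtain N where N: "negligible N"
    "\<And>x e. \<lbrakk>x \<notin> N; 0 < e\<rbrakk> \<Longrightarrow> \<exists>d>0. \<forall>k. 0 < k \<and> k < d \<longrightarrow>
        norm (integral (cbox x (x + k *\<^sub>R One)) f /\<^sub>R k ^ DIM(real) - f x) < e"
    using integrable_ccontinuous_explicit[of f] by metis
  have "h x = 0" if x: "x \<in> {a<..<b}" "x \<notin> N" for x
  proof (rule ccontr)
    assume "h x \<noteq> 0"
    then have "norm (h x) > 0" by simp
    then obtain d where d: "d > 0" "\<And>k. 0 < k \<Longrightarrow> k < d \<Longrightarrow>
        norm (integral (cbox x (x + k *\<^sub>R One)) f /\<^sub>R k ^ DIM(real) - f x) < norm (h x)"
      using N(2)[OF x(2) \<open>norm (h x) > 0\<close>] by auto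
    define k where "k = min (d / 2) ((b - x) / 2)"
    have "0 < k" using d(1) x by (simp add: k_def)
    moreover have "k \<le> d / 2" "k \<le> (b - x) / 2"
      unfolding k_def by (rule min.cobounded1, rule min.cobounded2)
    ultimately have k: "0 < k" "k < d" "x + k < b"
      using d(1) x by auto
    have "integral (cbox x (x + k *\<^sub>R One)) f = integral {x..x+k} h"
      using k x by (auto simp: f_def intro!: integral_cong)
    also have "\<dots> = 0" by (rule int0) (use k x in auto)
    finally show False using d(2)[OF k(1,2)] x by (simp add: f_def)
  qed
  then have "{x \<in> space lebesgue. \<not> (x \<in> {a<..<b} \<longrightarrow> h x = 0)} \<subseteq> N" by auto
  then have "AE x in lebesgue. x \<in> {a<..<b} \<longrightarrow> h x = 0"
    using N(1) unfolding negligible_iff_null_sets by (rule AE_I'[rotated])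
  then show ?thesis by (simp add: AE_restrict_space_iff)
qed

lemma Linf_on_test_function:
  assumes "test_function {a<..<b} p"
  shows "Linf_on {a<..<b} p" "Linf_on {a<..<b} (deriv p)"
  using test_function_continuous[OF assms] by (auto intro: Linf_on_continuous)

lemma weak_deriv_unique:
  fixes u :: "real \<Rightarrow> 'a::euclidean_space"
  assumes "is_weak_deriv {a<..<b} u g" "Linf_on {a<..<b} g"
    and "is_weak_deriv {a<..<b} u g'" "Linf_on {a<..<b} g'"
  shows "AE s in lebesgue_on {a<..<b}. g s = g' s"
proof -
  have "AE s in lebesgue_on {a<..<b}. g s - g' s = 0"
  proof (rule fundamental_lemma_variations)
    show "integrable (lebesgue_on {a<..<b}) (\<lambda>s. g s - g' s)"
      using assms by (intro Linf_on_integrable Linf_on_diff)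
    fix p assume p: "test_function {a<..<b} p"
    then have "(\<integral>s. p s *\<^sub>R g s \<partial>lebesgue_on {a<..<b}) = (\<integral>s. p s *\<^sub>R g' s \<partial>lebesgue_on {a<..<b})"
      using assms(1,3) unfolding is_weak_deriv_def by fastforce
    moreover have "integrable (lebesgue_on {a<..<b}) (\<lambda>s. p s *\<^sub>R g s)"
      "integrable (lebesgue_on {a<..<b}) (\<lambda>s. p s *\<^sub>R g' s)"
      using assms(2,4) Linf_on_test_function[OF p] by (auto intro: Linf_on_integrable Linf_on_scaleR)
    ultimately show "(\<integral>s. p s *\<^sub>R (g s - g' s) \<partial>lebesgue_on {a<..<b}) = 0"
      by (simp add: scaleR_diff_right)
  qed
  then show ?thesis by simp
qed

lemma is_weak_deriv_cong_AE:
  fixes u :: "real \<Rightarrow> 'a::euclidean_space"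
  assumes "Linf_on {a<..<b} u" "Linf_on {a<..<b} v"
    and "AE s in lebesgue_on {a<..<b}. u s = v s"
    and "is_weak_deriv {a<..<b} u g"
  shows "is_weak_deriv {a<..<b} v g"
  unfolding is_weak_deriv_def
proof (intro allI impI)
  fix p assume p: "test_function {a<..<b} p"
  have "(\<integral>s. deriv p s *\<^sub>R v s \<partial>lebesgue_on {a<..<b}) = (\<integral>s. deriv p s *\<^sub>R u s \<partial>lebesgue_on {a<..<b})"
  proof (rule integral_cong_AE)
    show "AE s in lebesgue_on {a<..<b}. deriv p s *\<^sub>R v s = deriv p s *\<^sub>R u s"
      using assms(3) by eventually_elim simp
  qed (use Linf_on_scaleR[OF Linf_on_test_function(2)[OF p]] assms in \<open>auto simp: Linf_on_def\<close>)
  also have "\<dots> = - (\<integral>s. p s *\<^sub>R g s \<partial>lebesgue_on {a<..<b})"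
    using assms(4) p by (simp add: is_weak_deriv_def)
  finally show "(\<integral>s. deriv p s *\<^sub>R v s \<partial>lebesgue_on {a<..<b}) = - (\<integral>s. p s *\<^sub>R g s \<partial>lebesgue_on {a<..<b})" .
qed

lemma is_weak_deriv_classical:
  fixes u :: "real \<Rightarrow> 'a::euclidean_space"
  assumes ab: "a \<le> b" and S: "finite S" and u: "continuous_on {a..b} u" and g: "Linf_on {a<..<b} g"
    and der: "\<And>x. x \<in> {a<..<b} - S \<Longrightarrow> (u has_vector_derivative g x) (at x)"
  shows "is_weak_deriv {a<..<b} u g"
  unfolding is_weak_deriv_def
proof (intro allI impI)
  fix p assume p: "test_function {a<..<b} p"
  note pc = test_function_continuous[OF p]
  have "((\<lambda>x. p x *\<^sub>R g x + deriv p x *\<^sub>R u x) has_integral (p b *\<^sub>R u b - p a *\<^sub>R u a)) {a..b}"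
  proof (rule fundamental_theorem_of_calculus_interior_strong[OF S ab])
    show "continuous_on {a..b} (\<lambda>x. p x *\<^sub>R u x)" by (intro continuous_intros pc u)
    show "((\<lambda>x. p x *\<^sub>R u x) has_vector_derivative p x *\<^sub>R g x + deriv p x *\<^sub>R u x) (at x)"
      if "x \<in> {a<..<b} - S" for x
      by (rule has_vector_derivative_scaleR[OF pc(3) der[OF that]])
  qed
  then have 0: "integral {a..b} (\<lambda>x. p x *\<^sub>R g x + deriv p x *\<^sub>R u x) = 0"
    using pc(4) by (simp add: integral_unique)
  have i1: "integrable (lebesgue_on {a<..<b}) (\<lambda>x. p x *\<^sub>R g x)"
    by (intro Linf_on_integrable Linf_on_scaleR Linf_on_test_function[OF p] g)
  have i2: "integrable (lebesgue_on {a<..<b}) (\<lambda>x. deriv p x *\<^sub>R u x)"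
    by (intro Linf_on_integrable Linf_on_scaleR Linf_on_test_function[OF p] Linf_on_continuous u)
  have "(\<integral>x. p x *\<^sub>R g x + deriv p x *\<^sub>R u x \<partial>lebesgue_on {a<..<b}) = 0"
    by (subst integral_lebesgue_on_open_interval) (use i1 i2 0 in auto)
  then show "(\<integral>s. deriv p s *\<^sub>R u s \<partial>lebesgue_on {a<..<b}) = - (\<integral>s. p s *\<^sub>R g s \<partial>lebesgue_on {a<..<b})"
    using i1 i2 by (simp add: eq_neg_iff_add_eq_0 add.commute)
qed

lemma weak_deriv_props:
  assumes "W1inf I u"
  shows "Linf_on I (weak_deriv I u)" "is_weak_deriv I u (weak_deriv I u)"
proof -
  have "Linf_on I (weak_deriv I u) \<and> is_weak_deriv I u (weak_deriv I u)"
    unfolding weak_deriv_def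
    by (rule someI_ex[of "\<lambda>g. Linf_on I g \<and> is_weak_deriv I u g"]) (use assms in \<open>simp add: W1inf_def\<close>)
  then show "Linf_on I (weak_deriv I u)" "is_weak_deriv I u (weak_deriv I u)" by auto
qed

text \<open>Tested against a plateau on \<open>{s..t}\<close> with steep sides, the left-hand side of the definition of the
  weak derivative is close to \<open>T s - T t\<close>, while the right-hand side is at most \<open>K (t - s)\<close> in norm.\<close>

lemma weak_deriv_bound_imp_lipschitz:
  fixes T :: "real \<Rightarrow> 'a::euclidean_space"
  assumes T: "continuous_on {a..b} T" and g: "Linf_on {a<..<b} g"
    and w: "is_weak_deriv {a<..<b} T g"
    and K: "AE s in lebesgue_on {a<..<b}. norm (g s) \<le> K"
    and st: "a \<le> s" "s \<le> t" "t \<le> b"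
  shows "norm (T t - T s) \<le> K * (t - s)"
proof (cases "s < t")
  case False
  with st show ?thesis by simp
next
  case True
  let ?M = "lebesgue_on {a<..<b}"
  have "norm (T t - T s) \<le> K * (t - s) + 2 * \<eta>" if "\<eta> > 0" for \<eta>
  proof -
    have sI: "s \<in> {a..b}" and tI: "t \<in> {a..b}" using st True by auto
    obtain d where d: "d > 0" "\<And>x. x \<in> {a..b} \<Longrightarrow> dist x s < d \<Longrightarrow> dist (T x) (T s) < \<eta>"
      using T[unfolded continuous_on_iff, rule_format, OF sI \<open>\<eta> > 0\<close>] by auto
    obtain d' where d': "d' > 0" "\<And>x. x \<in> {a..b} \<Longrightarrow> dist x t < d' \<Longrightarrow> dist (T x) (T t) < \<eta>"
      using T[unfolded continuous_on_iff, rule_format, OF tI \<open>\<eta> > 0\<close>] by auto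
    \<comment> \<open>The sides of the plateau, of width \<open>e\<close>, lie within distance \<open>2 e\<close> of \<open>s\<close> and \<open>t\<close>. It is
      supported in \<open>{s + e..t - e}\<close>, inside the open interval even when \<open>s = a\<close> or \<open>t = b\<close>.\<close>
    define e where "e = min (min d d') (t - s) / 4"
    have e: "e > 0" "2 * e < d" "2 * e < d'" "4 * e \<le> t - s"
      using d(1) d'(1) True by (auto simp: e_def min_def)
    define p q where "p = s + e" and "q = t - e"
    define \<psi> where "\<psi> = plateau p q e"
    have pq: "p + e \<le> q" "a < p" "q < b" using e st by (auto simp: p_def q_def)
    have test: "test_function {a<..<b} \<psi>"
      unfolding \<psi>_def by (rule test_function_plateau) (use e pq in auto)
    define \<eta>1 where "\<eta>1 c x = step' ((x - c) / e) / e" for c x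
    have c1: "continuous_on S (\<eta>1 c)" for S c
      unfolding \<eta>1_def by (intro continuous_intros) (use e in auto)
    have \<eta>1_nonneg: "\<eta>1 c x \<ge> 0" for c x
      using e step'_nonneg by (simp add: \<eta>1_def)
    have \<eta>1_0: "\<eta>1 c x = 0" if "x \<notin> {c<..<c+e}" for c x
      using that e step'_outside[of "(x - c) / e"] by (auto simp: \<eta>1_def divide_simps)
    have \<eta>1_int: "(\<eta>1 c has_integral 1) {a..b}" if "a \<le> c" "c + e \<le> b" for c
    proof -
      have "(\<eta>1 c has_integral step ((b - c) / e) - step ((a - c) / e)) {a..b}"
      proof (rule fundamental_theorem_of_calculus)
        have "((\<lambda>x. step ((x - c) / e)) has_field_derivative step' ((x - c) / e) * (1 / e)) (at x)" for x
          by (rule DERIV_chain2[OF step_deriv]) (use e in \<open>auto intro!: derivative_eq_intros\<close>)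
        from has_field_derivative_at_within[OF this]
        show "((\<lambda>x. step ((x - c) / e)) has_vector_derivative \<eta>1 c x) (at x within {a..b})" for x
          unfolding \<eta>1_def has_real_derivative_iff_has_vector_derivative[symmetric] by simp
      qed (use st True in auto)
      moreover have "step ((b - c) / e) = 1" "step ((a - c) / e) = 0"
        using that e by (auto intro!: step_0 step_1 simp: divide_simps)
      ultimately show ?thesis by simp
    qed
    have avg: "norm (integral {a..b} (\<lambda>x. \<eta>1 c x *\<^sub>R T x) - T r) \<le> \<eta>"
      if c: "a \<le> c" "c + e \<le> b" and near: "\<And>x. x \<in> {c<..<c+e} \<Longrightarrow> dist (T x) (T r) < \<eta>" for c r
    proof -
      have i1: "(\<lambda>x. \<eta>1 c x *\<^sub>R T x) integrable_on {a..b}"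
        by (intro integrable_continuous_real continuous_intros c1 T)
      have i2: "((\<lambda>x. \<eta>1 c x *\<^sub>R T r) has_integral T r) {a..b}"
        using has_integral_scaleR_left[OF \<eta>1_int[OF c], of "T r"] by simp
      have "integral {a..b} (\<lambda>x. \<eta>1 c x *\<^sub>R T x) - T r = integral {a..b} (\<lambda>x. \<eta>1 c x *\<^sub>R (T x - T r))"
        using i1 i2 by (simp add: scaleR_diff_right integral_diff has_integral_integrable integral_unique)
      also have "norm \<dots> \<le> integral {a..b} (\<lambda>x. \<eta>1 c x * \<eta>)"
      proof (rule integral_norm_bound_integral)
        show "norm (\<eta>1 c x *\<^sub>R (T x - T r)) \<le> \<eta>1 c x * \<eta>" for x
        proof (cases "x \<in> {c<..<c+e}")
          case True
          then show ?thesis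
            using near[OF True] \<eta>1_nonneg[of c x] by (auto simp: dist_norm intro!: mult_left_mono)
        qed (simp add: \<eta>1_0)
      qed (intro integrable_continuous_real continuous_intros c1 T)+
      also have "\<dots> = \<eta>"
        using integral_unique[OF has_integral_mult_left[OF \<eta>1_int[OF c], of \<eta>]] by simp
      finally show ?thesis .
    qed
    have dpsi: "deriv \<psi> x = \<eta>1 p x - \<eta>1 (q - e) x" for x
      unfolding \<psi>_def deriv_plateau[OF e(1)] \<eta>1_def by (simp add: diff_divide_distrib)
    have "(\<integral>x. deriv \<psi> x *\<^sub>R T x \<partial>?M) = integral {a..b} (\<lambda>x. deriv \<psi> x *\<^sub>R T x)"
      by (intro integral_lebesgue_on_open_interval Linf_on_integrable Linf_on_scaleR
          Linf_on_test_function[OF test] Linf_on_continuous T)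
    also have "\<dots> = integral {a..b} (\<lambda>x. \<eta>1 p x *\<^sub>R T x) - integral {a..b} (\<lambda>x. \<eta>1 (q - e) x *\<^sub>R T x)"
      unfolding dpsi scaleR_diff_left
      by (intro integral_diff integrable_continuous_real continuous_intros c1 T)
    finally have eq: "(\<integral>x. deriv \<psi> x *\<^sub>R T x \<partial>?M) =
      integral {a..b} (\<lambda>x. \<eta>1 p x *\<^sub>R T x) - integral {a..b} (\<lambda>x. \<eta>1 (q - e) x *\<^sub>R T x)" .
    have "norm (integral {a..b} (\<lambda>x. \<eta>1 p x *\<^sub>R T x) - T s) \<le> \<eta>"
      by (rule avg) (use e st in \<open>auto simp: p_def dist_real_def intro!: d(2)\<close>)
    moreover have "norm (integral {a..b} (\<lambda>x. \<eta>1 (q - e) x *\<^sub>R T x) - T t) \<le> \<eta>"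
      by (rule avg) (use e st in \<open>auto simp: q_def dist_real_def intro!: d'(2)\<close>)
    ultimately have "norm (integral {a..b} (\<lambda>x. \<eta>1 p x *\<^sub>R T x) - T s
        - (integral {a..b} (\<lambda>x. \<eta>1 (q - e) x *\<^sub>R T x) - T t)) \<le> \<eta> + \<eta>"
      by (rule norm_triangle_le_diff[OF add_mono])
    also have "integral {a..b} (\<lambda>x. \<eta>1 p x *\<^sub>R T x) - T s
        - (integral {a..b} (\<lambda>x. \<eta>1 (q - e) x *\<^sub>R T x) - T t) = (\<integral>x. deriv \<psi> x *\<^sub>R T x \<partial>?M) - (T s - T t)"
      unfolding eq by simp
    finally have 1: "norm ((\<integral>x. deriv \<psi> x *\<^sub>R T x \<partial>?M) - (T s - T t)) \<le> 2 * \<eta>"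
      by simp
    have ind: "indicat_real {a<..<b} x * indicat_real {p..q} x = indicat_real {p..q} x" for x
      using pq by (auto simp: indicator_def)
    have "norm (\<integral>x. \<psi> x *\<^sub>R g x \<partial>?M) \<le> (\<integral>x. norm (\<psi> x *\<^sub>R g x) \<partial>?M)"
      by (rule integral_norm_bound)
    also have "\<dots> \<le> (\<integral>x. K * indicat_real {p..q} x \<partial>?M)"
    proof (rule integral_mono_AE)
      show "integrable ?M (\<lambda>x. norm (\<psi> x *\<^sub>R g x))"
        by (intro integrable_norm Linf_on_integrable Linf_on_scaleR Linf_on_test_function[OF test] g)
      show "integrable ?M (\<lambda>x. K * indicat_real {p..q} x)"
        by (simp add: integrable_restrict_space ind flip: lmeasurable_iff_integrable)
      show "AE x in ?M. norm (\<psi> x *\<^sub>R g x) \<le> K * indicat_real {p..q} x"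
        using K
      proof eventually_elim
        case (elim x)
        have "\<psi> x * norm (g x) \<le> norm (g x)"
          unfolding \<psi>_def using plateau_bounds(1,2)[OF e(1) pq(1)] by (intro mult_left_le_one_le) auto
        with elim have "\<psi> x * norm (g x) \<le> K" by simp
        then show ?case
          using plateau_bounds(1,3)[OF e(1) pq(1), of x] unfolding \<psi>_def
          by (cases "x \<in> {p..q}") simp_all
      qed
    qed
    also have "\<dots> = K * (q - p)"
    proof -
      have "{p..q} \<inter> {a<..<b} = {p..q}" "{p..q} \<subseteq> {a<..<b}" using pq by auto
      then show ?thesis using pq e measure_restrict_space[of "{a<..<b}" lebesgue "{p..q}"] by simp
    qed
    finally have 2: "norm (\<integral>x. \<psi> x *\<^sub>R g x \<partial>?M) \<le> K * (q - p)" .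
    have 3: "(\<integral>x. deriv \<psi> x *\<^sub>R T x \<partial>?M) = - (\<integral>x. \<psi> x *\<^sub>R g x \<partial>?M)"
      using w test by (simp add: is_weak_deriv_def)
    have "T t - T s = ((\<integral>x. deriv \<psi> x *\<^sub>R T x \<partial>?M) - (T s - T t)) + (\<integral>x. \<psi> x *\<^sub>R g x \<partial>?M)"
      unfolding 3 by simp
    also have "norm \<dots> \<le> 2 * \<eta> + K * (q - p)"
      by (rule norm_triangle_mono[OF 1 2])
    also have "K * (q - p) \<le> K * (t - s)"
    proof -
      have "0 \<le> K * (q - p)" using norm_ge_zero 2 by (rule order_trans)
      moreover have "0 < q - p" using pq(1) e(1) by linarith
      ultimately have "K \<ge> 0" using zero_le_mult_iff[of K "q - p"] by auto
      then show ?thesis using e by (intro mult_left_mono) (auto simp: p_def q_def)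
    qed
    finally show ?thesis by simp
  qed
  show ?thesis
  proof (rule field_le_epsilon)
    fix e :: real assume "e > 0"
    then show "norm (T t - T s) \<le> K * (t - s) + e"
      using \<open>\<And>\<eta>. \<eta> > 0 \<Longrightarrow> norm (T t - T s) \<le> K * (t - s) + 2 * \<eta>\<close>[of "e / 2"] by simp
  qed
qed

section \<open>Curvature bounds and Lipschitz tangents\<close>

lemma max_curvature_le_imp_tangent_lipschitz:
  assumes W2: "W2inf {0<..<L} X"
    and X: "\<And>s. s \<in> {0..L} \<Longrightarrow> (X has_vector_derivative T s) (at s within {0..L})"
    and T: "continuous_on {0..L} T"
    and K: "max_curvature (L, X) \<le> ereal K"
    and st: "0 \<le> s" "s \<le> t" "t \<le> L"
  shows "norm (T t - T s) \<le> K * (t - s)"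
proof -
  let ?I = "{0<..<L}" and ?M = "lebesgue_on {0<..<L}"
  define w where "w = weak_deriv ?I X"
  define g where "g = weak_deriv ?I w"
  have "W1inf ?I X" "W1inf ?I w" using W2 by (auto simp: W2inf_def w_def)
  note w = weak_deriv_props[OF this(1), folded w_def] and g = weak_deriv_props[OF this(2), folded g_def]
  have LT: "Linf_on ?I T" by (rule Linf_on_continuous[OF T])
  have "is_weak_deriv ?I X T"
  proof (rule is_weak_deriv_classical[OF _ finite.emptyI _ LT])
    show "continuous_on {0..L} X"
      by (rule continuous_on_vector_derivative[OF X])
    show "(X has_vector_derivative T x) (at x)" if "x \<in> {0<..<L} - {}" for x
      using X[of x] that by (simp add: at_within_Icc_at)
  qed (use st in auto)
  from weak_deriv_unique[OF w(2,1) this LT] have "AE s in ?M. w s = T s" .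
  from is_weak_deriv_cong_AE[OF w(1) LT this g(2)] have wT: "is_weak_deriv ?I T g" .
  have "AE s in ?M. ereal (norm (g s)) \<le> max_curvature (L, X)"
    unfolding max_curvature_def Linf_norm_def by (simp add: w_def[symmetric] g_def[symmetric] esssup_AE)
  then have "AE s in ?M. norm (g s) \<le> K"
    by eventually_elim (use K order_trans ereal_less_eq(3) in blast)
  from weak_deriv_bound_imp_lipschitz[OF T g(1) wT this st] show ?thesis .
qed

lemma piecewise_C2_max_curvature_le:
  assumes L: "0 \<le> L" and S: "finite S"
    and X: "\<And>s. s \<in> {0..L} \<Longrightarrow> (X has_vector_derivative T s) (at s within {0..L})"
    and T: "continuous_on {0..L} T"
    and g: "g \<in> borel_measurable (lebesgue_on {0<..<L})"
    and T': "\<And>s. s \<in> {0<..<L} - S \<Longrightarrow> (T has_vector_derivative g s) (at s)"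
    and K: "\<And>s. s \<in> {0<..<L} \<Longrightarrow> norm (g s) \<le> K"
  shows "W2inf {0<..<L} X" "max_curvature (L, X) \<le> ereal K"
proof -
  let ?I = "{0<..<L}" and ?M = "lebesgue_on {0<..<L}"
  have LT: "Linf_on ?I T" by (rule Linf_on_continuous[OF T])
  have Lg: "Linf_on ?I g"
    unfolding Linf_on_def using g K by (auto intro!: exI[of _ K] AE_I2)
  have cX: "continuous_on {0..L} X"
    by (rule continuous_on_vector_derivative[OF X])
  have XT: "is_weak_deriv ?I X T"
  proof (rule is_weak_deriv_classical[OF L finite.emptyI cX LT])
    show "(X has_vector_derivative T x) (at x)" if "x \<in> {0<..<L} - {}" for x
      using X[of x] that by (simp add: at_within_Icc_at)
  qed
  have Tg: "is_weak_deriv ?I T g"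
    by (rule is_weak_deriv_classical[OF L S T Lg T'])
  have W1X: "W1inf ?I X"
    unfolding W1inf_def using Linf_on_continuous[OF cX] LT XT by blast
  define w where "w = weak_deriv ?I X"
  note w = weak_deriv_props[OF W1X, folded w_def]
  have Tw: "AE s in ?M. T s = w s" by (rule weak_deriv_unique[OF XT LT w(2,1)])
  have wg: "is_weak_deriv ?I w g" by (rule is_weak_deriv_cong_AE[OF LT w(1) Tw Tg])
  have W1w: "W1inf ?I w"
    unfolding W1inf_def using w(1) Lg wg by blast
  show "W2inf ?I X" using W1X W1w by (simp add: W2inf_def w_def)
  define h where "h = weak_deriv ?I w"
  note h = weak_deriv_props[OF W1w, folded h_def]
  have "AE s in ?M. g s = h s" by (rule weak_deriv_unique[OF wg Lg h(2,1)])
  moreover have "AE s in ?M. norm (g s) \<le> K" using K by (intro AE_I2) auto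
  ultimately have "AE s in ?M. ereal (norm (h s)) \<le> ereal K" by eventually_elim simp
  moreover have [measurable]: "h \<in> borel_measurable ?M"
    using h(1) by (simp add: Linf_on_def)
  have "(\<lambda>s. ereal (norm (h s))) \<in> borel_measurable ?M"
    by measurable
  ultimately have "esssup ?M (\<lambda>s. ereal (norm (h s))) \<le> ereal K"
    by (rule esssup_I[rotated])
  then show "max_curvature (L, X) \<le> ereal K"
    by (simp add: max_curvature_def Linf_norm_def h_def w_def)
qed

section \<open>Increments bounded below by a quadratic term\<close>

text \<open>Dividing \<open>{x..y}\<close> into \<open>n\<close> equal parts divides the total defect by \<open>n\<close>.\<close>

lemma nondecreasing_if_quadratic_defect:
  fixes f :: "real \<Rightarrow> real"
  assumes f: "\<And>x y. a \<le> x \<Longrightarrow> x \<le> y \<Longrightarrow> y \<le> b \<Longrightarrow> f x - C * (y - x)\<^sup>2 \<le> f y"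
    and xy: "a \<le> x" "x \<le> y" "y \<le> b"
  shows "f x \<le> f y"
proof -
  have sub: "f x - C * (y - x)\<^sup>2 * inverse (real (Suc n)) \<le> f y" for n
  proof -
    define h where "h = (y - x) / real (Suc n)"
    have h: "h \<ge> 0" "real (Suc n) * h = y - x" using xy by (auto simp: h_def)
    have "f x - real i * (C * h\<^sup>2) \<le> f (x + real i * h)" if "i \<le> Suc n" for i
      using that
    proof (induction i)
      case (Suc i)
      have "real (Suc i) * h \<le> real (Suc n) * h"
        using Suc.prems h(1) by (intro mult_right_mono) auto
      then have "x + real (Suc i) * h \<le> b" using h xy by linarith
      then have "f (x + real i * h) - C * (x + real (Suc i) * h - (x + real i * h))\<^sup>2 \<le> f (x + real (Suc i) * h)"
        using xy h(1) by (intro f) (auto simp: algebra_simps intro: add_increasing2)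
      with Suc show ?case by (simp add: algebra_simps)
    qed simp
    from this[of "Suc n"] have "f x - real (Suc n) * (C * h\<^sup>2) \<le> f y"
      using h(2) by simp
    moreover have "real (Suc n) * (C * h\<^sup>2) = C * (y - x)\<^sup>2 * inverse (real (Suc n))"
      unfolding h(2)[symmetric] by (simp add: power2_eq_square field_simps del: of_nat_Suc)
    ultimately show ?thesis by (simp only:)
  qed
  have "(\<lambda>n. f x - C * (y - x)\<^sup>2 * inverse (real (Suc n))) \<longlonglongrightarrow> f x - 0"
    by (intro tendsto_diff tendsto_const tendsto_mult_right_zero LIMSEQ_inverse_real_of_nat)
  then have "(\<lambda>n. f x - C * (y - x)\<^sup>2 * inverse (real (Suc n))) \<longlonglongrightarrow> f x" by simp
  then show ?thesis
    by (rule LIMSEQ_le_const2) (use sub in blast)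
qed

lemma sin_ge_quadratic: "x \<ge> 0 \<Longrightarrow> x - x\<^sup>2 / 2 \<le> sin x" for x :: real
proof -
  assume x: "x \<ge> 0"
  have "(\<lambda>x. sin x - (x - x\<^sup>2 / 2)) 0 \<le> (\<lambda>x. sin x - (x - x\<^sup>2 / 2)) x"
  proof (rule DERIV_nonneg_imp_nondecreasing[OF x])
    fix u :: real assume u: "0 \<le> u"
    have "((\<lambda>x. sin x - (x - x\<^sup>2 / 2)) has_real_derivative cos u - 1 + u) (at u)"
      by (auto intro!: derivative_eq_intros)
    moreover have "1 - u \<le> cos u"
    proof -
      have "2 * (sin (u/2))\<^sup>2 = 2 * (\<bar>sin (u/2)\<bar> * \<bar>sin (u/2)\<bar>)"
        by (simp add: power2_eq_square)
      also have "\<dots> \<le> 2 * (\<bar>sin (u/2)\<bar> * 1)"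
        by (intro mult_left_mono) auto
      also have "\<dots> \<le> 2 * \<bar>u/2\<bar>"
        using abs_sin_x_le_abs_x[of "u/2"] by simp
      finally show ?thesis using cos_double_sin[of "u/2"] u by simp
    qed
    ultimately show "\<exists>y. ((\<lambda>x. sin x - (x - x\<^sup>2 / 2)) has_real_derivative y) (at u) \<and> 0 \<le> y"
      by (intro exI[of _ "cos u - 1 + u"]) auto
  qed
  then show ?thesis by simp
qed

lemma mult_cos_le_sin:
  assumes "0 \<le> x" "x \<le> c" "c < pi / 2"
  shows "x * cos c \<le> sin (x::real)"
proof -
  have "(\<lambda>x. sin x - x * cos c) 0 \<le> (\<lambda>x. sin x - x * cos c) x"
  proof (rule DERIV_nonneg_imp_nondecreasing[OF assms(1)])
    fix u :: real assume u: "0 \<le> u" "u \<le> x"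
    have "((\<lambda>x. sin x - x * cos c) has_real_derivative cos u - cos c) (at u)"
      by (auto intro!: derivative_eq_intros)
    moreover have "cos c \<le> cos u" using u assms by (intro cos_monotone_0_pi_le) auto
    ultimately show "\<exists>y. ((\<lambda>x. sin x - x * cos c) has_real_derivative y) (at u) \<and> 0 \<le> y"
      by (intro exI[of _ "cos u - cos c"]) auto
  qed
  then show ?thesis by simp
qed

text \<open>The chord between two unit vectors at angle \<open>u\<close> has length \<open>2 sin (u / 2)\<close>, which is \<open>u\<close> up to a
  quadratic error; the bound on the total angle makes \<open>u\<close> itself of the order of \<open>t - s\<close>.\<close>

lemma angle_lipschitz_if_chord_lipschitz:
  fixes \<phi> :: "real \<Rightarrow> real"
  assumes mono: "mono_on {a..b} \<phi>" and range: "\<phi> b - \<phi> a < pi"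
    and chord: "\<And>s t. a \<le> s \<Longrightarrow> s \<le> t \<Longrightarrow> t \<le> b \<Longrightarrow> 2 * sin ((\<phi> t - \<phi> s) / 2) \<le> K * (t - s)"
    and st: "a \<le> s" "s \<le> t" "t \<le> b"
  shows "\<phi> t - \<phi> s \<le> K * (t - s)"
proof -
  \<comment> \<open>On the range at hand \<open>c u / 2 \<le> sin (u / 2)\<close>, whence the crude bound \<open>u \<le> K (y - x) / c\<close>.\<close>
  define c where "c = cos ((\<phi> b - \<phi> a) / 2)"
  have ab: "\<phi> a \<le> \<phi> b" using st by (intro mono_onD[OF mono]) auto
  have c: "c > 0" unfolding c_def using range ab by (intro cos_gt_zero_pi) auto
  have "K * s - \<phi> s \<le> K * t - \<phi> t"
  proof (rule nondecreasing_if_quadratic_defect[OF _ st, of "\<lambda>s. K * s - \<phi> s" "(K / c)\<^sup>2 / 4"])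
    fix x y assume xy: "a \<le> x" "x \<le> y" "y \<le> b"
    define u where "u = \<phi> y - \<phi> x"
    have "\<phi> a \<le> \<phi> x" "\<phi> x \<le> \<phi> y" "\<phi> y \<le> \<phi> b"
      using xy by (auto intro!: mono_onD[OF mono])
    then have u: "0 \<le> u" "u \<le> \<phi> b - \<phi> a" by (auto simp: u_def)
    have ch: "2 * sin (u / 2) \<le> K * (y - x)" using chord[OF xy] by (simp add: u_def)
    have "u / 2 * c \<le> sin (u / 2)"
      unfolding c_def by (rule mult_cos_le_sin) (use u range in auto)
    with ch have "u * c \<le> K * (y - x)" by simp
    then have "u \<le> (K / c) * (y - x)" using c by (simp add: field_simps)
    then have "u\<^sup>2 \<le> ((K / c) * (y - x))\<^sup>2" using u by (intro power_mono) auto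
    moreover have "u - u\<^sup>2 / 4 \<le> 2 * sin (u / 2)"
      using sin_ge_quadratic[of "u / 2"] u by (simp add: power2_eq_square)
    ultimately have "u \<le> K * (y - x) + (K / c)\<^sup>2 / 4 * (y - x)\<^sup>2"
      using ch unfolding power_mult_distrib by linarith
    then show "K * x - \<phi> x - (K / c)\<^sup>2 / 4 * (y - x)\<^sup>2 \<le> K * y - \<phi> y"
      by (simp add: u_def algebra_simps)
  qed
  then show ?thesis by (simp add: algebra_simps)
qed

section \<open>Rigidity of extremal angles\<close>

text \<open>The integrated form of \<open>sin \<phi> \<ge> R \<phi>' sin \<phi> = - R (cos \<phi>)'\<close>.\<close>

lemma sin_integral_defect_mono:
  fixes \<phi> :: "real \<Rightarrow> real"
  assumes R: "R > 0" and cont: "continuous_on {0..L} \<phi>" and mono: "mono_on {0..L} \<phi>"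
    and bounds: "0 \<le> \<phi> 0" "\<phi> L \<le> pi"
    and lip: "\<And>s t. 0 \<le> s \<Longrightarrow> s \<le> t \<Longrightarrow> t \<le> L \<Longrightarrow> \<phi> t - \<phi> s \<le> (t - s) / R"
    and st: "0 \<le> s" "s \<le> t" "t \<le> L"
  shows "integral {0..s} (\<lambda>u. sin (\<phi> u)) + R * cos (\<phi> s) \<le> integral {0..t} (\<lambda>u. sin (\<phi> u)) + R * cos (\<phi> t)"
proof (rule nondecreasing_if_quadratic_defect[OF _ st,
    of "\<lambda>s. integral {0..s} (\<lambda>u. sin (\<phi> u)) + R * cos (\<phi> s)" "1 / R"])
  fix x y assume xy: "0 \<le> x" "x \<le> y" "y \<le> L"
  have int: "(\<lambda>u. sin (\<phi> u)) integrable_on {p..q}" if "0 \<le> p" "q \<le> L" for p q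
    using that by (intro integrable_continuous_real continuous_intros continuous_on_subset[OF cont]) auto
  have le: "0 \<le> \<phi> x" "\<phi> x \<le> \<phi> y" "\<phi> y \<le> pi"
    using xy bounds mono_onD[OF mono, of 0 x] mono_onD[OF mono, of x y] mono_onD[OF mono, of y L] by auto
  obtain \<xi> where \<xi>: "\<phi> x \<le> \<xi>" "\<xi> \<le> \<phi> y" "cos (\<phi> x) - cos (\<phi> y) = (\<phi> y - \<phi> x) * sin \<xi>"
  proof (cases "\<phi> x = \<phi> y")
    case True
    then show ?thesis using that[of "\<phi> x"] by simp
  next
    case False
    then have "\<exists>z. \<phi> x < z \<and> z < \<phi> y \<and> cos (\<phi> y) - cos (\<phi> x) = (\<phi> y - \<phi> x) * (- sin z)"
      using le by (intro MVT2) (auto intro!: derivative_eq_intros)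
    then obtain z where z: "\<phi> x < z" "z < \<phi> y" "cos (\<phi> y) - cos (\<phi> x) = (\<phi> y - \<phi> x) * (- sin z)"
      by blast
    have "cos (\<phi> x) - cos (\<phi> y) = (\<phi> y - \<phi> x) * sin z" using z(3) by (simp add: algebra_simps)
    with z show ?thesis by (intro that[of z]) auto
  qed
  have "sin \<xi> \<ge> 0" using \<xi> le by (intro sin_ge_zero) auto
  have d: "\<phi> y - \<phi> x \<le> (y - x) / R" by (rule lip[OF xy])
  have "R * (cos (\<phi> x) - cos (\<phi> y)) = (R * (\<phi> y - \<phi> x)) * sin \<xi>" by (simp add: \<xi>)
  also have "\<dots> \<le> (y - x) * sin \<xi>"
    using d R \<open>sin \<xi> \<ge> 0\<close> by (intro mult_right_mono) (auto simp: field_simps)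
  also have "\<dots> = integral {x..y} (\<lambda>u. sin \<xi> - (y - x) / R) + (y - x)\<^sup>2 / R"
    using xy R by (simp add: power2_eq_square field_simps)
  also have "integral {x..y} (\<lambda>u. sin \<xi> - (y - x) / R) \<le> integral {x..y} (\<lambda>u. sin (\<phi> u))"
  proof (rule integral_le)
    fix u assume u: "u \<in> {x..y}"
    have "\<phi> x \<le> \<phi> u" "\<phi> u \<le> \<phi> y" using u xy by (auto intro!: mono_onD[OF mono])
    then have "\<bar>\<phi> u - \<xi>\<bar> \<le> (y - x) / R" using \<xi> d by auto
    moreover have "\<bar>sin (\<phi> u) - sin \<xi>\<bar> \<le> \<bar>\<phi> u - \<xi>\<bar>"
    proof -
      have "\<bar>sin (\<phi> u) - sin \<xi>\<bar> = 2 * (\<bar>sin ((\<phi> u - \<xi>) / 2)\<bar> * \<bar>cos ((\<phi> u + \<xi>) / 2)\<bar>)"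
        by (simp add: sin_diff_sin abs_mult)
      also have "\<dots> \<le> 2 * \<bar>sin ((\<phi> u - \<xi>) / 2)\<bar>" by (simp add: mult_left_le)
      also have "\<dots> \<le> \<bar>\<phi> u - \<xi>\<bar>" using abs_sin_x_le_abs_x[of "(\<phi> u - \<xi>) / 2"] by simp
      finally show ?thesis .
    qed
    ultimately show "sin \<xi> - (y - x) / R \<le> sin (\<phi> u)" by linarith
  qed (use xy in \<open>auto intro!: int\<close>)
  finally have *: "R * (cos (\<phi> x) - cos (\<phi> y)) \<le> integral {x..y} (\<lambda>u. sin (\<phi> u)) + (y - x)\<^sup>2 / R" by simp
  have "integral {0..x} (\<lambda>u. sin (\<phi> u)) + integral {x..y} (\<lambda>u. sin (\<phi> u)) = integral {0..y} (\<lambda>u. sin (\<phi> u))"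
    using xy by (intro Henstock_Kurzweil_Integration.integral_combine int) auto
  with * show "integral {0..x} (\<lambda>u. sin (\<phi> u)) + R * cos (\<phi> x) - 1 / R * (y - x)\<^sup>2
      \<le> integral {0..y} (\<lambda>u. sin (\<phi> u)) + R * cos (\<phi> y)"
    by (simp add: algebra_simps)
qed

text \<open>The case of equality in the lower bound for the integral of \<open>sin \<phi>\<close>: the angle stays \<open>0\<close> on a
  segment and then grows at the maximal rate.\<close>

lemma segment_arc_rigidity:
  fixes \<phi> :: "real \<Rightarrow> real"
  assumes R: "R > 0" and L: "L > 0" and cont: "continuous_on {0..L} \<phi>" and mono: "mono_on {0..L} \<phi>"
    and bounds: "\<phi> 0 = 0" "\<phi> L < pi"
    and lip: "\<And>s t. 0 \<le> s \<Longrightarrow> s \<le> t \<Longrightarrow> t \<le> L \<Longrightarrow> \<phi> t - \<phi> s \<le> (t - s) / R"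
    and small: "integral {0..L} (\<lambda>u. sin (\<phi> u)) \<le> R * (1 - cos (\<phi> L))"
    and s: "s \<in> {0..L}"
  shows "\<phi> s = max 0 (\<phi> L - (L - s) / R)"
proof -
  define G where "G s = integral {0..s} (\<lambda>u. sin (\<phi> u)) + R * cos (\<phi> s)" for s
  have G: "G x \<le> G y" if "0 \<le> x" "x \<le> y" "y \<le> L" for x y
    unfolding G_def by (rule sin_integral_defect_mono[OF R cont mono _ _ lip that]) (use bounds in auto)
  have Gc: "G x = R" if "x \<in> {0..L}" for x
  proof -
    have "G 0 = R" using bounds by (simp add: G_def)
    moreover have "G L \<le> R" using small by (simp add: G_def algebra_simps)
    ultimately show ?thesis using G[of 0 x] G[of x L] that by auto
  qed
  \<comment> \<open>Equality makes \<open>G\<close> constant. So \<open>cos \<phi>\<close>, and \<open>\<phi>\<close> itself where it is positive, is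
    differentiable everywhere in the classical sense.\<close>
  have cos: "cos (\<phi> x) = 1 - integral {0..x} (\<lambda>u. sin (\<phi> u)) / R" if "x \<in> {0..L}" for x
    using Gc[OF that] R by (simp add: G_def field_simps)
  have nonneg: "0 \<le> \<phi> s" using mono_onD[OF mono, of 0 s] s bounds by auto
  show ?thesis
  proof (cases "\<phi> s = 0")
    case True
    then show ?thesis using lip[of s L] s by auto
  next
    case False
    have der: "(\<phi> has_vector_derivative 1 / R) (at u within {s..L})" if u: "u \<in> {s..L}" for u
    proof -
      have range: "0 < \<phi> v" "\<phi> v < pi" if "v \<in> {s..L}" for v
        using that s False nonneg bounds(2) mono_onD[OF mono, of s v] mono_onD[OF mono, of v L] by auto
      have "((\<lambda>v. integral {0..v} (\<lambda>u. sin (\<phi> u))) has_vector_derivative sin (\<phi> u)) (at u within {0..L})"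
        by (rule integral_has_vector_derivative) (use u s cont in \<open>auto intro!: continuous_intros\<close>)
      then have "((\<lambda>v. integral {0..v} (\<lambda>u. sin (\<phi> u))) has_real_derivative sin (\<phi> u)) (at u within {s..L})"
        using s unfolding has_real_derivative_iff_has_vector_derivative
        by (auto intro: has_vector_derivative_within_subset)
      then have "((\<lambda>v. 1 - integral {0..v} (\<lambda>u. sin (\<phi> u)) / R) has_real_derivative - sin (\<phi> u) / R) (at u within {s..L})"
        using R by (auto intro!: derivative_eq_intros)
      then have c: "((\<lambda>v. cos (\<phi> v)) has_real_derivative - sin (\<phi> u) / R) (at u within {s..L})"
        by (rule has_field_derivative_transform_within[OF _ zero_less_one u]) (use cos s in auto)
      have "(cos (\<phi> u))\<^sup>2 \<noteq> 1" using sin_gt_zero[OF range[OF u]] by (simp add: cos_squared_eq)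
      then have "cos (\<phi> u) \<noteq> 1" "cos (\<phi> u) \<noteq> - 1" by auto
      then have lt: "- 1 < cos (\<phi> u)" "cos (\<phi> u) < 1"
        using cos_le_one[of "\<phi> u"] cos_ge_minus_one[of "\<phi> u"] by linarith+
      have "((\<lambda>v. arccos (cos (\<phi> v))) has_real_derivative
          inverse (- sqrt (1 - (cos (\<phi> u))\<^sup>2)) * (- sin (\<phi> u) / R)) (at u within {s..L})"
        by (rule DERIV_chain2[OF DERIV_arccos[OF lt] c])
      also have "inverse (- sqrt (1 - (cos (\<phi> u))\<^sup>2)) * (- sin (\<phi> u) / R) = 1 / R"
        using sin_gt_zero[OF range[OF u]] by (simp add: sin_squared_eq[symmetric])
      finally have "(\<phi> has_real_derivative 1 / R) (at u within {s..L})"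
        by (rule has_field_derivative_transform_within[OF _ zero_less_one u]) (use range in \<open>auto simp: arccos_cos less_imp_le\<close>)
      then show ?thesis by (simp add: has_real_derivative_iff_has_vector_derivative)
    qed
    have "((\<lambda>_. 1 / R) has_integral \<phi> L - \<phi> s) {s..L}"
      by (rule fundamental_theorem_of_calculus) (use s der in auto)
    moreover have "((\<lambda>_. 1 / R) has_integral (L - s) * (1 / R)) {s..L}"
      using has_integral_const_real[of "1 / R" s L] s by simp
    ultimately have "\<phi> L - \<phi> s = (L - s) / R" by (auto dest: has_integral_unique)
    with nonneg show ?thesis by auto
  qed
qed

text \<open>The mirror image of the previous lemma, for the curve traversed backwards.\<close>

lemma arc_segment_rigidity:
  fixes \<phi> :: "real \<Rightarrow> real"
  assumes R: "R > 0" and L: "L > 0" and cont: "continuous_on {0..L} \<phi>" and mono: "mono_on {0..L} \<phi>"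
    and bounds: "\<phi> 0 = 0" "\<phi> L < pi"
    and lip: "\<And>s t. 0 \<le> s \<Longrightarrow> s \<le> t \<Longrightarrow> t \<le> L \<Longrightarrow> \<phi> t - \<phi> s \<le> (t - s) / R"
    and small: "integral {0..L} (\<lambda>u. sin (\<phi> L - \<phi> u)) \<le> R * (1 - cos (\<phi> L))"
    and s: "s \<in> {0..L}"
  shows "\<phi> s = min (\<phi> L) (s / R)"
proof -
  define \<psi> where "\<psi> s = \<phi> L - \<phi> (L - s)" for s
  have "\<psi> (L - s) = max 0 (\<psi> L - (L - (L - s)) / R)"
  proof (rule segment_arc_rigidity[OF R L])
    show "continuous_on {0..L} \<psi>"
      unfolding \<psi>_def by (intro continuous_intros continuous_on_compose2[OF cont]) auto
    show "mono_on {0..L} \<psi>"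
      unfolding \<psi>_def by (intro mono_onI diff_left_mono mono_onD[OF mono]) auto
    show "\<psi> t - \<psi> s \<le> (t - s) / R" if "0 \<le> s" "s \<le> t" "t \<le> L" for s t
      using lip[of "L - t" "L - s"] that by (simp add: \<psi>_def)
    have "((\<lambda>u. sin (\<phi> L - \<phi> u)) has_integral integral {0..L} (\<lambda>u. sin (\<phi> L - \<phi> u))) {0..L}"
      by (intro integrable_integral integrable_continuous_real continuous_intros cont)
    from has_integral_affinity[of _ _ 0 L "-1" L, unfolded cbox_interval, OF this]
    have "((\<lambda>u. sin (\<psi> u)) has_integral integral {0..L} (\<lambda>u. sin (\<phi> L - \<phi> u))) {0..L}"
      by (simp add: \<psi>_def)
    then show "integral {0..L} (\<lambda>u. sin (\<psi> u)) \<le> R * (1 - cos (\<psi> L))"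
      using small bounds by (simp add: integral_unique \<psi>_def)
  qed (use bounds s in \<open>auto simp: \<psi>_def\<close>)
  then show ?thesis using bounds by (auto simp: \<psi>_def max_def min_def split: if_splits)
qed

section \<open>Angles in the plane\<close>

lemma rot90_inner [simp]: "u \<bullet> rot90 u = 0" "rot90 u \<bullet> u = 0" "norm (rot90 u) = norm u"
  by (simp_all add: rot90_def inner_vec_def norm_vec_def L2_set_def sum_2 algebra_simps)

lemma unit_vector_polar:
  fixes v :: "real^2"
  assumes "norm v = 1"
  obtains \<theta> where "v = vector [cos \<theta>, sin \<theta>]"
proof -
  have "(v$1)\<^sup>2 + (v$2)\<^sup>2 = 1"
    using assms by (simp add: norm_vec_def L2_set_def sum_2)
  then obtain \<theta> where "v$1 = cos \<theta>" "v$2 = sin \<theta>"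
    using sincos_total_2pi by metis
  then have "v = vector [cos \<theta>, sin \<theta>]" by (simp add: vec_eq_iff forall_2)
  then show ?thesis by (rule that)
qed

lemma oriented_angle_unit:
  assumes "norm u = 1" "norm v = 1"
  shows "v = cos (oriented_angle u v) *\<^sub>R u + sin (oriented_angle u v) *\<^sub>R rot90 u"
proof -
  obtain p where p: "u = vector [cos p, sin p]" by (rule unit_vector_polar[OF assms(1)])
  obtain q where q: "v = vector [cos q, sin q]" by (rule unit_vector_polar[OF assms(2)])
  have rot: "cos t *\<^sub>R u + sin t *\<^sub>R rot90 u = vector [cos (p + t), sin (p + t)]" for t
    by (simp add: p rot90_def vec_eq_iff forall_2 cos_add sin_add algebra_simps)
  have eq: "v = cos t *\<^sub>R u + sin t *\<^sub>R rot90 u \<longleftrightarrow> (\<exists>n::int. t = q - p + 2 * pi * n)" for t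
  proof -
    have "v = cos t *\<^sub>R u + sin t *\<^sub>R rot90 u \<longleftrightarrow> sin (p + t) = sin q \<and> cos (p + t) = cos q"
      unfolding rot q by (auto simp: vec_eq_iff forall_2)
    also have "\<dots> \<longleftrightarrow> (\<exists>n::int. t = q - p + 2 * pi * n)"
      unfolding sin_cos_eq_iff by (rule ex_cong1) linarith
    finally show ?thesis .
  qed
  have "\<exists>!t. - pi < t \<and> t \<le> pi \<and> (\<exists>n::int. t = q - p + 2 * pi * n)"
  proof -
    define n where "n = \<lfloor>(pi - (q - p)) / (2 * pi)\<rfloor>"
    have n: "of_int n \<le> (pi - (q - p)) / (2 * pi)" "(pi - (q - p)) / (2 * pi) < of_int n + 1"
      unfolding n_def by (rule of_int_floor_le, rule real_of_int_floor_add_one_gt)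
    show ?thesis
    proof (rule ex1I[of _ "q - p + 2 * pi * n"])
      show "- pi < q - p + 2 * pi * n \<and> q - p + 2 * pi * n \<le> pi \<and>
          (\<exists>k::int. q - p + 2 * pi * n = q - p + 2 * pi * k)"
        using n by (auto simp: pos_le_divide_eq pos_divide_less_eq algebra_simps)
    next
      fix t assume t: "- pi < t \<and> t \<le> pi \<and> (\<exists>k::int. t = q - p + 2 * pi * k)"
      then obtain k :: int where k: "t = q - p + 2 * pi * k" by blast
      have "of_int k \<le> (pi - (q - p)) / (2 * pi)" "(pi - (q - p)) / (2 * pi) < of_int k + 1"
        using t by (auto simp: k pos_le_divide_eq pos_divide_less_eq algebra_simps)
      then have "k = n" unfolding n_def by (rule floor_unique[symmetric])
      then show "t = q - p + 2 * pi * n" using k by simp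
    qed
  qed
  then have "\<exists>!t. - pi < t \<and> t \<le> pi \<and> v = cos t *\<^sub>R u + sin t *\<^sub>R rot90 u"
    unfolding eq .
  from theI'[OF this] show ?thesis unfolding oriented_angle_def by blast
qed

section \<open>Curves with the same derivative\<close>

lemma eq_on_interval_if_same_derivative:
  fixes f g :: "real \<Rightarrow> 'a::banach"
  assumes "\<And>s. s \<in> {a..b} \<Longrightarrow> (f has_vector_derivative T s) (at s within {a..b})"
    and "\<And>s. s \<in> {a..b} \<Longrightarrow> (g has_vector_derivative T s) (at s within {a..b})"
    and "f a = g a" and s: "s \<in> {a..b}"
  shows "f s = g s"
proof -
  have sub: "{a..s} \<subseteq> {a..b}" using s by auto
  have "(T has_integral f s - f a) {a..s}"
    by (rule fundamental_theorem_of_calculus)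
       (use s in \<open>auto intro!: has_vector_derivative_within_subset[OF assms(1) sub]\<close>)
  moreover have "(T has_integral g s - g a) {a..s}"
    by (rule fundamental_theorem_of_calculus)
       (use s in \<open>auto intro!: has_vector_derivative_within_subset[OF assms(2) sub]\<close>)
  ultimately have "f s - f a = g s - g a" by (rule has_integral_unique)
  with assms(3) show ?thesis by simp
qed

lemma tangent_eqI:
  assumes "0 < L" "s \<in> {0..L}" "(X has_vector_derivative v) (at s within {0..L})"
  shows "tangent (L, X) s = v"
  unfolding tangent_def using vector_derivative_within_cbox[of 0 L s X v] assms by simp

lemma vector_derivative_unique_Icc:
  assumes "a < b" "s \<in> {a..b}"
    and "(f has_vector_derivative d) (at s within {a..b})" "(f has_vector_derivative e) (at s within {a..b})"
  shows "d = e"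
  using vector_derivative_unique_within_closed_interval[of a b s f d e] assms by simp

section \<open>The profile of an arc between two segments\<close>

text \<open>The tangent angle of a segment of length \<open>l\<close>, followed by an arc of radius \<open>R\<close> and angle \<open>\<Omega>\<close>,
  followed by a segment. Allowing both segments treats the two orders of arc and segment at once.\<close>

definition profile :: "real \<Rightarrow> real \<Rightarrow> real \<Rightarrow> real \<Rightarrow> real" where
  "profile \<Omega> R l s = min \<Omega> (max 0 ((s - l) / R))"

lemma profile_cont: "R \<noteq> 0 \<Longrightarrow> continuous_on S (profile \<Omega> R l)"
  unfolding profile_def by (intro continuous_intros) auto

lemma profile_mono: "R > 0 \<Longrightarrow> mono_on S (profile \<Omega> R l)"
  unfolding profile_def by (intro mono_onI min.mono max.mono divide_right_mono) auto

lemma profile_has_integral: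
  fixes f F :: "real \<Rightarrow> 'a::banach"
  assumes R: "R > 0" and \<Omega>: "\<Omega> \<ge> 0" and l: "l \<ge> 0" "l' \<ge> 0"
    and F: "\<And>x. (F has_vector_derivative f x) (at x)"
  shows "((\<lambda>s. f (profile \<Omega> R l s)) has_integral l *\<^sub>R f 0 + R *\<^sub>R (F \<Omega> - F 0) + l' *\<^sub>R f \<Omega>)
           {0..l + R * \<Omega> + l'}"
proof -
  let ?g = "\<lambda>s. f (profile \<Omega> R l s)"
  have 1: "(?g has_integral l *\<^sub>R f 0) {0..l}"
  proof (rule has_integral_eq)
    show "((\<lambda>_. f 0) has_integral l *\<^sub>R f 0) {0..l}"
      using has_integral_const_real[of "f 0" 0 l] l by simp
  qed (use R \<Omega> in \<open>auto simp: profile_def divide_le_0_iff\<close>)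
  have 2: "(?g has_integral R *\<^sub>R F \<Omega> - R *\<^sub>R F 0) {l..l + R * \<Omega>}"
  proof (rule has_integral_eq)
    have "((\<lambda>s. f ((s - l) / R)) has_integral R *\<^sub>R F ((l + R * \<Omega> - l) / R) - R *\<^sub>R F ((l - l) / R)) {l..l + R * \<Omega>}"
    proof (rule fundamental_theorem_of_calculus)
      fix x
      have "((\<lambda>s. (s - l) / R) has_vector_derivative 1 / R) (at x within {l..l + R * \<Omega>})"
        using R by (auto intro!: derivative_eq_intros simp: has_real_derivative_iff_has_vector_derivative[symmetric])
      from has_vector_derivative_scaleR[OF DERIV_const vector_diff_chain_within[OF this has_vector_derivative_at_within[OF F]], of R]
      show "((\<lambda>s. R *\<^sub>R F ((s - l) / R)) has_vector_derivative f ((x - l) / R)) (at x within {l..l + R * \<Omega>})"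
        using R by (simp add: o_def)
    qed (use R \<Omega> in auto)
    then show "((\<lambda>s. f ((s - l) / R)) has_integral R *\<^sub>R F \<Omega> - R *\<^sub>R F 0) {l..l + R * \<Omega>}"
      using R by simp
  qed (use R \<Omega> in \<open>auto simp: profile_def field_simps max_def min_def\<close>)
  have 3: "(?g has_integral l' *\<^sub>R f \<Omega>) {l + R * \<Omega>..l + R * \<Omega> + l'}"
  proof (rule has_integral_eq)
    show "((\<lambda>_. f \<Omega>) has_integral l' *\<^sub>R f \<Omega>) {l + R * \<Omega>..l + R * \<Omega> + l'}"
      using has_integral_const_real[of "f \<Omega>" "l + R * \<Omega>" "l + R * \<Omega> + l'"] l by simp
  next
    fix s assume "s \<in> {l + R * \<Omega>..l + R * \<Omega> + l'}"
    then have "\<Omega> \<le> (s - l) / R" using R by (simp add: field_simps)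
    then show "f \<Omega> = ?g s" using \<Omega> by (simp add: profile_def)
  qed
  have R\<Omega>: "0 \<le> R * \<Omega>" using R \<Omega> by simp
  from has_integral_combine[OF _ _ has_integral_combine[OF _ _ 1 2] 3] R\<Omega> l
  show ?thesis by (simp add: scaleR_diff_right)
qed

section \<open>Arcs in terms of tangents\<close>

lemma vector_2_decompose: "vector [x, y] = x *\<^sub>R vector [1, 0] + y *\<^sub>R (vector [0, 1] :: real^2)"
  by (simp add: vec_eq_iff forall_2)

text \<open>The inner product of two tangents of an arc does not depend on the direction in which it is
  traversed.\<close>

lemma arc_on_tangent_inner:
  assumes R: "R > 0" and arc: "arc_on R u v X" and uv: "u < v"
    and X: "\<And>s. s \<in> {u..v} \<Longrightarrow> (X has_vector_derivative T s) (at s within {u..v})"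
    and st: "s \<in> {u..v}" "t \<in> {u..v}"
  shows "T s \<bullet> T t = cos ((t - s) / R)"
proof -
  obtain p \<theta> \<epsilon> where "\<epsilon> \<in> {1, -1}" and
    Xe: "\<And>s. s \<in> {u..v} \<Longrightarrow> X s = p + R *\<^sub>R vector [cos (\<theta> + \<epsilon> * (s - u) / R), sin (\<theta> + \<epsilon> * (s - u) / R)]"
    using arc unfolding arc_on_def by blast
  then have eps: "\<epsilon> = 1 \<or> \<epsilon> = -1" by blast
  define D where "D s = \<epsilon> *\<^sub>R (vector [- sin (\<theta> + \<epsilon> * (s - u) / R), cos (\<theta> + \<epsilon> * (s - u) / R)] :: real^2)" for s
  have TD: "T s = D s" if "s \<in> {u..v}" for s
  proof (rule vector_derivative_unique_Icc[OF uv that X[OF that]])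
    have 1: "((\<lambda>s. cos (\<theta> + \<epsilon> * (s - u) / R)) has_real_derivative - sin (\<theta> + \<epsilon> * (s - u) / R) * (\<epsilon> / R)) (at s within {u..v})"
      "((\<lambda>s. sin (\<theta> + \<epsilon> * (s - u) / R)) has_real_derivative cos (\<theta> + \<epsilon> * (s - u) / R) * (\<epsilon> / R)) (at s within {u..v})"
      using R by (auto intro!: derivative_eq_intros)
    have "((\<lambda>s. p + R *\<^sub>R (cos (\<theta> + \<epsilon> * (s - u) / R) *\<^sub>R vector [1, 0] + sin (\<theta> + \<epsilon> * (s - u) / R) *\<^sub>R vector [0, 1]))
        has_vector_derivative D s) (at s within {u..v})"
      unfolding D_def using R
      by (auto intro!: derivative_eq_intros has_vector_derivative_scaleR 1 simp: vec_eq_iff forall_2)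
    then show "(X has_vector_derivative D s) (at s within {u..v})"
      by (rule has_vector_derivative_transform[OF that, rotated]) (simp add: Xe vector_2_decompose[symmetric])
  qed
  define x y where "x = \<theta> + \<epsilon> * (s - u) / R" and "y = \<theta> + \<epsilon> * (t - u) / R"
  have "T s \<bullet> T t = cos (y - x)"
    using eps unfolding TD[OF st(1)] TD[OF st(2)] D_def x_def[symmetric] y_def[symmetric]
    by (auto simp: inner_vec_def sum_2 cos_diff)
  also have "y - x = \<epsilon> * ((t - s) / R)" by (simp add: x_def y_def diff_divide_distrib algebra_simps)
  also have "cos \<dots> = cos ((t - s) / R)" using eps by (elim disjE) (simp_all only: mult_1 mult_minus1 cos_minus)
  finally show ?thesis .
qed

lemma segment_on_tangent_const:
  assumes seg: "segment_on u v X" and uv: "u < v"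
    and X: "\<And>s. s \<in> {u..v} \<Longrightarrow> (X has_vector_derivative T s) (at s within {u..v})"
    and st: "s \<in> {u..v}" "t \<in> {u..v}"
  shows "T s = T t"
proof -
  obtain p d where Xe: "\<And>s. s \<in> {u..v} \<Longrightarrow> X s = p + (s - u) *\<^sub>R d"
    using seg unfolding segment_on_def by auto
  have "T s = d" if "s \<in> {u..v}" for s
  proof (rule vector_derivative_unique_Icc[OF uv that X[OF that]])
    have "((\<lambda>s. p + (s - u) *\<^sub>R d) has_vector_derivative d) (at s within {u..v})"
      by (auto intro!: derivative_eq_intros)
    then show "(X has_vector_derivative d) (at s within {u..v})"
      by (rule has_vector_derivative_transform[OF that, rotated]) (simp add: Xe)
  qed
  with st show ?thesis by simp
qed

section \<open>The corner and its admissible curves\<close>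

text \<open>The data of the theorem. Inside the locale \<open>a\<close> and \<open>b\<close> are the lengths of the sides and \<open>\<omega>\<close> the
  turning angle at the corner.\<close>

locale corner =
  fixes P A B :: "real^2"
  assumes PA: "P \<noteq> A" and PB: "P \<noteq> B"
    and Omega_pos: "0 < Omega P A B" and Omega_less_pi: "Omega P A B < pi"
begin

abbreviation \<omega> :: real where "\<omega> \<equiv> Omega P A B"
abbreviation a :: real where "a \<equiv> dist P A"
abbreviation b :: real where "b \<equiv> dist P B"
abbreviation \<kappa> :: "real^2" where "\<kappa> \<equiv> rot90 (alpha P A)"

text \<open>The unit vector at angle \<open>t\<close> from \<open>\<alpha>\<close>.\<close>

definition dir :: "real \<Rightarrow> real^2" where
  "dir t = cos t *\<^sub>R alpha P A + sin t *\<^sub>R \<kappa>"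

lemma norm_alpha: "norm (alpha P A) = 1" and norm_beta: "norm (beta P B) = 1"
  using PA PB by (simp_all add: alpha_def beta_def dist_norm norm_minus_commute)

lemma inner_frame: "alpha P A \<bullet> alpha P A = 1" "\<kappa> \<bullet> \<kappa> = 1"
  using norm_alpha by (simp_all add: dot_square_norm)

lemma beta_eq: "beta P B = dir \<omega>"
  unfolding dir_def Omega_def by (rule oriented_angle_unit[OF norm_alpha norm_beta])

lemma dir_0: "dir 0 = alpha P A" by (simp add: dir_def)

lemma displacement: "B - A = a *\<^sub>R alpha P A + b *\<^sub>R dir \<omega>"
  unfolding beta_eq[symmetric] using PA PB by (simp add: alpha_def beta_def)

lemma dir_inner: "dir s \<bullet> dir t = cos (t - s)"
  by (simp add: dir_def inner_add_left inner_add_right inner_frame cos_diff)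

lemma norm_dir: "norm (dir t) = 1"
  using dir_inner[of t t] by (simp add: norm_eq_sqrt_inner)

lemma dir_cont: "continuous_on S f \<Longrightarrow> continuous_on S (\<lambda>s. dir (f s))" for f :: "real \<Rightarrow> real"
  unfolding dir_def by (auto intro!: continuous_intros)

lemma dir_chord: "2 * sin ((t - s) / 2) \<le> norm (dir t - dir s)"
proof -
  have "(norm (dir t - dir s))\<^sup>2 = 2 - 2 * cos (t - s)"
    by (simp add: power2_norm_eq_inner inner_diff_left inner_diff_right dir_inner
        cos_minus[of "t - s", simplified])
  also have "cos (t - s) = 1 - 2 * (sin ((t - s) / 2))\<^sup>2"
    using cos_double_sin[of "(t - s) / 2"] by (simp only: nonzero_mult_div_cancel_left times_divide_eq_right zero_neq_numeral not_False_eq_True)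
  also have "2 - 2 * (1 - 2 * (sin ((t - s) / 2))\<^sup>2) = (2 * sin ((t - s) / 2))\<^sup>2"
    by (simp add: power_mult_distrib)
  finally have "norm (dir t - dir s) = \<bar>2 * sin ((t - s) / 2)\<bar>"
    by (metis abs_norm_cancel power2_eq_iff_nonneg abs_ge_zero power2_abs)
  then show ?thesis by simp
qed

lemma dir_deriv: "(dir has_vector_derivative cos t *\<^sub>R \<kappa> - sin t *\<^sub>R alpha P A) (at t)"
  unfolding dir_def by (auto intro!: derivative_eq_intros has_vector_derivative_scaleR)

lemma dir_primitive:
  "((\<lambda>t. sin t *\<^sub>R alpha P A - cos t *\<^sub>R \<kappa>) has_vector_derivative dir t) (at t)"
  unfolding dir_def by (auto intro!: derivative_eq_intros has_vector_derivative_scaleR)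

lemma trig_Omega: "0 < sin \<omega>" "0 < 1 - cos \<omega>" "sin \<omega> * sin \<omega> = (1 - cos \<omega>) * (1 + cos \<omega>)"
proof -
  show "0 < sin \<omega>" using Omega_pos Omega_less_pi by (rule sin_gt_zero)
  show "0 < 1 - cos \<omega>" using cos_monotone_0_pi[of 0 \<omega>] Omega_pos Omega_less_pi by simp
  show "sin \<omega> * sin \<omega> = (1 - cos \<omega>) * (1 + cos \<omega>)"
    using sin_squared_eq[of \<omega>] by (simp add: power2_eq_square algebra_simps)
qed

text \<open>The function \<open>\<phi>\<close> is the tangent angle of a curve \<open>X\<close> with the prescribed end points and end
  tangents; only the Sobolev regularity and the extensionality of \<open>X\<close> are left out.\<close>

definition admissible_angle :: "real \<Rightarrow> (real \<Rightarrow> real^2) \<Rightarrow> (real \<Rightarrow> real) \<Rightarrow> bool" where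
  "admissible_angle L X \<phi> \<longleftrightarrow>
     0 < L \<and> continuous_on {0..L} \<phi> \<and> mono_on {0..L} \<phi> \<and> \<phi> 0 = 0 \<and> \<phi> L = \<omega> \<and> X 0 = A \<and> X L = B \<and>
     (\<forall>s\<in>{0..L}. (X has_vector_derivative dir (\<phi> s)) (at s within {0..L}))"

lemma curves_iff:
  "(L, X) \<in> curves P A B \<longleftrightarrow>
     X \<in> extensional {0..L} \<and> W2inf {0<..<L} X \<and> (\<exists>\<phi>. admissible_angle L X \<phi>)"
proof
  assume c: "(L, X) \<in> curves P A B"
  then have L: "0 < L" and X: "X \<in> extensional {0..L}" "W2inf {0<..<L} X"
    and d: "\<And>s. s \<in> {0..L} \<Longrightarrow> X differentiable (at s within {0..L})"
    and e: "X 0 = A" "X L = B"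
    unfolding curves_def by auto
  obtain \<phi> where \<phi>: "continuous_on {0..L} \<phi>" "\<phi> 0 = 0" "\<phi> L = \<omega>" "mono_on {0..L} \<phi>"
    "\<And>s. s \<in> {0..L} \<Longrightarrow> tangent (L, X) s = dir (\<phi> s)"
    using c unfolding curves_def dir_def by auto
  have "(X has_vector_derivative dir (\<phi> s)) (at s within {0..L})" if "s \<in> {0..L}" for s
    using d[OF that] \<phi>(5)[OF that] by (simp add: tangent_def vector_derivative_works)
  with L e \<phi> have "admissible_angle L X \<phi>" by (simp add: admissible_angle_def)
  with X show "X \<in> extensional {0..L} \<and> W2inf {0<..<L} X \<and> (\<exists>\<phi>. admissible_angle L X \<phi>)" by blast
next
  assume r: "X \<in> extensional {0..L} \<and> W2inf {0<..<L} X \<and> (\<exists>\<phi>. admissible_angle L X \<phi>)"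
  then obtain \<phi> where \<phi>: "0 < L" "continuous_on {0..L} \<phi>" "mono_on {0..L} \<phi>" "\<phi> 0 = 0" "\<phi> L = \<omega>"
    "X 0 = A" "X L = B" "\<And>s. s \<in> {0..L} \<Longrightarrow> (X has_vector_derivative dir (\<phi> s)) (at s within {0..L})"
    unfolding admissible_angle_def by blast
  have t: "tangent (L, X) s = dir (\<phi> s)" if "s \<in> {0..L}" for s
    by (rule tangent_eqI[OF \<phi>(1) that \<phi>(8)[OF that]])
  have "continuous_on {0..L} (tangent (L, X))"
    using dir_cont[OF \<phi>(2)] by (rule continuous_on_eq) (simp add: t)
  moreover have "X differentiable (at s within {0..L})" if "s \<in> {0..L}" for s
    using \<phi>(8)[OF that] by (rule differentiableI_vector)
  moreover have "\<exists>\<phi>. continuous_on {0..L} \<phi> \<and> \<phi> 0 = 0 \<and> \<phi> L = \<omega> \<and>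
        (\<forall>s\<in>{0..L}. tangent (L, X) s = cos (\<phi> s) *\<^sub>R alpha P A + sin (\<phi> s) *\<^sub>R \<kappa>) \<and>
        mono_on {0..L} \<phi>"
    using \<phi> t by (intro exI[of _ \<phi>]) (simp add: dir_def)
  ultimately show "(L, X) \<in> curves P A B"
    unfolding curves_def using r \<phi>(1,4,5,6,7) t by (simp add: norm_dir dir_0 beta_eq)
qed

text \<open>The displacement \<open>B - A\<close>, as the integral of the tangent, projected on the normal of \<open>\<alpha>\<close> and on
  the normal of \<open>\<beta>\<close>.\<close>

lemma angle_integrals:
  assumes "admissible_angle L X \<phi>"
  shows "((\<lambda>s. sin (\<phi> s)) has_integral b * sin \<omega>) {0..L}"
    and "((\<lambda>s. sin (\<omega> - \<phi> s)) has_integral a * sin \<omega>) {0..L}"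
proof -
  have *: "((\<lambda>s. dir (\<phi> s)) has_integral X L - X 0) {0..L}"
    by (rule fundamental_theorem_of_calculus) (use assms in \<open>auto simp: admissible_angle_def\<close>)
  have XL: "X L - X 0 = a *\<^sub>R alpha P A + b *\<^sub>R dir \<omega>"
    using assms displacement by (simp add: admissible_angle_def)
  have "((\<lambda>s. dir (\<phi> s) \<bullet> \<kappa>) has_integral (X L - X 0) \<bullet> \<kappa>) {0..L}"
    using has_integral_linear[OF * bounded_linear_inner_left[of \<kappa>]] by (simp add: o_def)
  then show "((\<lambda>s. sin (\<phi> s)) has_integral b * sin \<omega>) {0..L}"
    unfolding XL by (simp add: dir_def inner_add_left inner_frame)
  let ?n = "sin \<omega> *\<^sub>R alpha P A - cos \<omega> *\<^sub>R \<kappa>"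
  have "((\<lambda>s. dir (\<phi> s) \<bullet> ?n) has_integral (X L - X 0) \<bullet> ?n) {0..L}"
    using has_integral_linear[OF * bounded_linear_inner_left[of ?n]] by (simp add: o_def)
  moreover have "dir t \<bullet> ?n = sin (\<omega> - t)" for t
    by (simp add: dir_def inner_add_left inner_diff_right inner_frame sin_diff)
  moreover have "(X L - X 0) \<bullet> ?n = a * sin \<omega>"
    unfolding XL by (simp add: dir_def inner_add_left inner_diff_right inner_frame algebra_simps)
  ultimately show "((\<lambda>s. sin (\<omega> - \<phi> s)) has_integral a * sin \<omega>) {0..L}"
    by simp
qed

section \<open>The extremal curve\<close>

text \<open>The arc is tangent to both sides at distance \<open>m = min a b\<close> from the corner, which fixes its radius
  \<open>rad\<close>; the rest of the longer side is the segment. At most one of the two segment lengths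
  \<open>a - m\<close> and \<open>b - m\<close> is nonzero. The curve \<open>arcseg\<close>, of length \<open>len\<close>, is obtained by integrating
  the tangent with angle \<open>ang\<close>; the restriction makes it extensional.\<close>

definition m :: real where "m = min a b"
definition rad :: real where "rad = m * sin \<omega> / (1 - cos \<omega>)"
definition len :: real where "len = (a - m) + rad * \<omega> + (b - m)"
definition ang :: "real \<Rightarrow> real" where "ang = profile \<omega> rad (a - m)"
definition X0 :: "real \<Rightarrow> real^2" where "X0 s = A + integral {0..s} (\<lambda>u. dir (ang u))"
definition arcseg :: curve where "arcseg = (len, restrict X0 {0..len})"

lemma m_bounds: "0 < m" "m \<le> a" "m \<le> b" "m = a \<or> m = b"
  using PA PB by (auto simp: m_def)

lemma rad_pos: "0 < rad"
  using m_bounds(1) trig_Omega by (simp add: rad_def)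

lemma rad_eqs: "rad * (1 - cos \<omega>) = m * sin \<omega>" "rad * sin \<omega> = m * (1 + cos \<omega>)"
proof -
  show "rad * (1 - cos \<omega>) = m * sin \<omega>" using trig_Omega(2) by (simp add: rad_def)
  show "rad * sin \<omega> = m * (1 + cos \<omega>)"
    using trig_Omega(2) unfolding rad_def by (simp add: mult.assoc trig_Omega(3) nonzero_divide_eq_eq)
qed

lemma len_pos: "0 < len"
  using m_bounds mult_pos_pos[OF rad_pos Omega_pos] by (simp add: len_def)

lemma ang_cont: "continuous_on S ang"
  unfolding ang_def using rad_pos by (intro profile_cont) auto

lemma X0_deriv:
  assumes "s \<in> {0..len}"
  shows "(X0 has_vector_derivative dir (ang s)) (at s within {0..len})"
proof -
  have "((\<lambda>s. integral {0..s} (\<lambda>u. dir (ang u))) has_vector_derivative dir (ang s)) (at s within {0..len})"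
    by (rule integral_has_vector_derivative[OF dir_cont[OF ang_cont] assms])
  from has_vector_derivative_add[OF has_vector_derivative_const this, of A]
  show ?thesis by (simp add: X0_def[abs_def])
qed

lemma X0_restrict_deriv:
  assumes "s \<in> {0..len}"
  shows "(restrict X0 {0..len} has_vector_derivative dir (ang s)) (at s within {0..len})"
  by (rule has_vector_derivative_transform[OF assms _ X0_deriv[OF assms]]) auto

lemma X0_end: "X0 len = B"
proof -
  have "((\<lambda>s. dir (ang s)) has_integral (a - m) *\<^sub>R dir 0 +
      rad *\<^sub>R ((sin \<omega> *\<^sub>R alpha P A - cos \<omega> *\<^sub>R \<kappa>) - (sin 0 *\<^sub>R alpha P A - cos 0 *\<^sub>R \<kappa>)) +
      (b - m) *\<^sub>R dir \<omega>) {0..len}"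
    unfolding ang_def len_def
    by (rule profile_has_integral[OF rad_pos _ _ _ dir_primitive]) (use m_bounds Omega_pos in auto)
  then have "integral {0..len} (\<lambda>s. dir (ang s)) = (a - m) *\<^sub>R alpha P A +
      (rad * sin \<omega>) *\<^sub>R alpha P A + (rad * (1 - cos \<omega>)) *\<^sub>R \<kappa> + (b - m) *\<^sub>R dir \<omega>"
    by (simp add: integral_unique dir_0 algebra_simps)
  also have "\<dots> = a *\<^sub>R alpha P A + b *\<^sub>R dir \<omega>"
    unfolding rad_eqs by (simp add: dir_def algebra_simps)
  finally show ?thesis by (simp add: X0_def displacement[symmetric])
qed

lemma arcseg_angle: "admissible_angle len (restrict X0 {0..len}) ang"
  unfolding admissible_angle_def
proof (intro conjI ballI)
  show "mono_on {0..len} ang" unfolding ang_def by (rule profile_mono[OF rad_pos])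
  show "ang 0 = 0" using m_bounds rad_pos Omega_pos
    by (simp add: ang_def profile_def divide_le_0_iff)
  have "\<omega> \<le> (len - (a - m)) / rad" using m_bounds rad_pos by (simp add: len_def field_simps)
  then show "ang len = \<omega>" using Omega_pos by (simp add: ang_def profile_def)
qed (use len_pos ang_cont X0_end X0_restrict_deriv in \<open>auto simp: X0_def\<close>)

lemma arcseg_W2_curvature: "W2inf {0<..<len} (restrict X0 {0..len})" "max_curvature arcseg \<le> ereal (1 / rad)"
proof -
  define u v where "u = a - m" and "v = a - m + rad * \<omega>"
  define g where "g s = (if s \<in> {u<..<v} then (1 / rad) *\<^sub>R (cos (ang s) *\<^sub>R \<kappa> - sin (ang s) *\<^sub>R alpha P A) else 0)" for s
  have uv: "u < v" using rad_pos Omega_pos by (simp add: u_def v_def)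
  have "ang s = 0" if "s \<le> u" for s
  proof -
    have "(s - u) / rad \<le> 0" using that rad_pos by (simp add: divide_le_0_iff)
    then show ?thesis using Omega_pos by (simp add: ang_def profile_def u_def)
  qed
  moreover have "ang s = \<omega>" if "v \<le> s" for s
  proof -
    have "\<omega> \<le> (s - u) / rad" using that rad_pos by (simp add: u_def v_def field_simps)
    then show ?thesis using Omega_pos by (simp add: ang_def profile_def u_def)
  qed
  moreover have "ang s = (s - u) / rad" if "s \<in> {u..v}" for s
  proof -
    have "0 \<le> (s - u) / rad" "(s - u) / rad \<le> \<omega>" using that rad_pos by (auto simp: u_def v_def field_simps)
    then show ?thesis by (simp add: ang_def profile_def u_def)
  qed
  ultimately have cases: "s \<le> u \<Longrightarrow> ang s = 0" "v \<le> s \<Longrightarrow> ang s = \<omega>"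
    "s \<in> {u..v} \<Longrightarrow> ang s = (s - u) / rad" for s by blast+
  have gm: "g \<in> borel_measurable (lebesgue_on {0<..<len})"
  proof -
    have [measurable]: "ang \<in> borel_measurable borel"
      by (rule borel_measurable_continuous_onI[OF ang_cont])
    have "g \<in> borel_measurable borel" unfolding g_def by measurable
    then show ?thesis by (intro measurable_restrict_space1 measurable_completion) simp
  qed
  have der: "((\<lambda>s. dir (ang s)) has_vector_derivative g s) (at s)" if s: "s \<notin> {u, v}" for s
  proof -
    consider "s < u" | "s > v" | "s \<in> {u<..<v}" using s by fastforce
    then show ?thesis
    proof cases
      case 1
      have "((\<lambda>s. dir (ang s)) has_vector_derivative 0) (at s)"
        by (rule has_vector_derivative_transform_within_open[of "\<lambda>_. dir 0" _ _ "{..<u}"])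
           (use 1 cases in auto)
      with 1 show ?thesis by (simp add: g_def)
    next
      case 2
      have "((\<lambda>s. dir (ang s)) has_vector_derivative 0) (at s)"
        by (rule has_vector_derivative_transform_within_open[of "\<lambda>_. dir \<omega>" _ _ "{v<..}"])
           (use 2 cases in auto)
      with 2 show ?thesis by (simp add: g_def)
    next
      case 3
      have "((\<lambda>s. (s - u) / rad) has_vector_derivative 1 / rad) (at s)"
        using rad_pos by (auto intro!: derivative_eq_intros simp: has_real_derivative_iff_has_vector_derivative[symmetric])
      from vector_diff_chain_at[OF this dir_deriv]
      have "((\<lambda>s. dir ((s - u) / rad)) has_vector_derivative g s) (at s)"
        using 3 cases(3)[of s] by (simp add: g_def o_def)
      then show ?thesis
        by (rule has_vector_derivative_transform_within_open[of _ _ _ "{u<..<v}"])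
           (use 3 cases in auto)
    qed
  qed
  have bound: "norm (g s) \<le> 1 / rad" for s
  proof -
    have "norm (cos t *\<^sub>R \<kappa> - sin t *\<^sub>R alpha P A) = 1" for t
      by (simp add: norm_eq_sqrt_inner inner_diff_left inner_diff_right inner_frame
          power2_eq_square[symmetric])
    then show ?thesis using rad_pos by (simp add: g_def)
  qed
  note * = piecewise_C2_max_curvature_le[OF less_imp_le[OF len_pos] _ X0_restrict_deriv dir_cont[OF ang_cont] gm der bound, of "{u, v}"]
  show "W2inf {0<..<len} (restrict X0 {0..len})" by (rule *) auto
  show "max_curvature arcseg \<le> ereal (1 / rad)" unfolding arcseg_def by (rule *) auto
qed

lemma arcseg_in_curves: "arcseg \<in> curves P A B"
  unfolding arcseg_def curves_iff using arcseg_angle arcseg_W2_curvature(1) by auto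

section \<open>Rigidity of the extremal curve\<close>

text \<open>A curve that turns along one arc, with a segment on at most one side, is \<open>arcseg\<close>: the two integrals
  give \<open>R (1 - cos \<omega>) = (a - l) sin \<omega> = (b - l') sin \<omega>\<close>, and this determines \<open>R\<close>, \<open>l\<close> and \<open>l'\<close>.\<close>

lemma profile_curve_unique:
  assumes adm: "admissible_angle L X \<phi>" and ext: "X \<in> extensional {0..L}"
    and R: "0 < R" and l: "0 \<le> l" "0 \<le> l'" "l = 0 \<or> l' = 0" and L: "L = l + R * \<omega> + l'"
    and \<phi>: "\<And>s. s \<in> {0..L} \<Longrightarrow> \<phi> s = profile \<omega> R l s"
  shows "(L, X) = arcseg"
proof -
  have "((\<lambda>s. sin (profile \<omega> R l s)) has_integral l *\<^sub>R sin 0 + R *\<^sub>R (- cos \<omega> - (- cos 0)) + l' *\<^sub>R sin \<omega>) {0..L}"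
    unfolding L by (rule profile_has_integral[OF R _ l(1,2)])
      (use Omega_pos in \<open>auto intro!: derivative_eq_intros simp: has_real_derivative_iff_has_vector_derivative[symmetric]\<close>)
  moreover have "((\<lambda>s. sin (profile \<omega> R l s)) has_integral b * sin \<omega>) {0..L}"
    using angle_integrals(1)[OF adm] by (rule has_integral_eq[rotated]) (simp add: \<phi>)
  ultimately have "l *\<^sub>R sin 0 + R *\<^sub>R (- cos \<omega> - (- cos 0)) + l' *\<^sub>R sin \<omega> = b * sin \<omega>"
    by (rule has_integral_unique)
  then have 1: "R * (1 - cos \<omega>) = (b - l') * sin \<omega>" by (simp add: algebra_simps)
  have "((\<lambda>s. sin (\<omega> - profile \<omega> R l s)) has_integral l *\<^sub>R sin (\<omega> - 0) + R *\<^sub>R (cos (\<omega> - \<omega>) - cos (\<omega> - 0)) + l' *\<^sub>R sin (\<omega> - \<omega>)) {0..L}"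
    unfolding L by (rule profile_has_integral[OF R _ l(1,2)])
      (use Omega_pos in \<open>auto intro!: derivative_eq_intros simp: has_real_derivative_iff_has_vector_derivative[symmetric]\<close>)
  moreover have "((\<lambda>s. sin (\<omega> - profile \<omega> R l s)) has_integral a * sin \<omega>) {0..L}"
    using angle_integrals(2)[OF adm] by (rule has_integral_eq[rotated]) (simp add: \<phi>)
  ultimately have "l *\<^sub>R sin (\<omega> - 0) + R *\<^sub>R (cos (\<omega> - \<omega>) - cos (\<omega> - 0)) + l' *\<^sub>R sin (\<omega> - \<omega>) = a * sin \<omega>"
    by (rule has_integral_unique)
  then have 2: "R * (1 - cos \<omega>) = (a - l) * sin \<omega>" by (simp add: algebra_simps)
  from 1 2 trig_Omega(1) have "a - l = b - l'" by simp
  then have m: "a - l = m" "b - l' = m" using l unfolding m_def by auto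
  have "R = rad" using 2 trig_Omega(2) unfolding m(1) by (simp add: rad_def field_simps)
  moreover have "l = a - m" "l' = b - m" using m by auto
  ultimately have eq: "L = len" "\<And>s. s \<in> {0..len} \<Longrightarrow> \<phi> s = ang s"
    using \<phi> L by (simp_all add: len_def ang_def)
  have "X s = restrict X0 {0..len} s" if "s \<in> {0..len}" for s
  proof (rule eq_on_interval_if_same_derivative[OF _ X0_restrict_deriv _ that])
    show "(X has_vector_derivative dir (ang s)) (at s within {0..len})" if "s \<in> {0..len}" for s
      using adm that eq by (simp add: admissible_angle_def)
    show "X 0 = restrict X0 {0..len} 0"
      using adm len_pos by (simp add: admissible_angle_def X0_def)
  qed
  then have "X = restrict X0 {0..len}"
    using ext unfolding eq(1) by (intro extensionalityI[of _ "{0..len}"]) auto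
  then show ?thesis by (simp add: arcseg_def eq(1))
qed

text \<open>The bound makes the angle \<open>1 / rad\<close>-Lipschitz, and for this radius the lower bound for one of the
  two integrals, the one belonging to the shorter side, is an equality.\<close>

lemma small_curvature_imp_arcseg:
  assumes c: "c \<in> curves P A B" and K: "max_curvature c \<le> ereal (1 / rad)"
  shows "c = arcseg"
proof -
  obtain L X where cL: "c = (L, X)" by (cases c)
  from c obtain \<phi> where ext: "X \<in> extensional {0..L}" and W2: "W2inf {0<..<L} X" and adm: "admissible_angle L X \<phi>"
    unfolding cL curves_iff by blast
  then have L: "0 < L" and cont: "continuous_on {0..L} \<phi>" and mono: "mono_on {0..L} \<phi>"
    and ends: "\<phi> 0 = 0" "\<phi> L = \<omega>"
    and X: "\<And>s. s \<in> {0..L} \<Longrightarrow> (X has_vector_derivative dir (\<phi> s)) (at s within {0..L})"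
    by (auto simp: admissible_angle_def)
  have lip: "\<phi> t - \<phi> s \<le> (t - s) / rad" if "0 \<le> s" "s \<le> t" "t \<le> L" for s t
  proof -
    have "\<phi> t - \<phi> s \<le> 1 / rad * (t - s)"
    proof (rule angle_lipschitz_if_chord_lipschitz[OF mono _ _ that])
      show "2 * sin ((\<phi> t - \<phi> s) / 2) \<le> 1 / rad * (t - s)" if "0 \<le> s" "s \<le> t" "t \<le> L" for s t
        using dir_chord[of "\<phi> t" "\<phi> s"]
          max_curvature_le_imp_tangent_lipschitz[OF W2 X dir_cont[OF cont] K[unfolded cL] that]
        by linarith
    qed (use ends Omega_less_pi in auto)
    then show ?thesis by simp
  qed
  have lmin: "0 \<le> L - rad * \<omega>"
    using lip[of 0 L] L ends rad_pos by (simp add: field_simps)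
  note bal = angle_integrals[OF adm]
  have "(L, X) = arcseg"
  proof (cases "b \<le> a")
    case True
    then have m: "m = b" by (simp add: m_def)
    have \<phi>: "\<phi> s = max 0 (\<phi> L - (L - s) / rad)" if "s \<in> {0..L}" for s
    proof (rule segment_arc_rigidity[OF rad_pos L cont mono ends(1) _ lip _ that])
      show "integral {0..L} (\<lambda>u. sin (\<phi> u)) \<le> rad * (1 - cos (\<phi> L))"
        using bal(1) rad_eqs(1) by (simp add: ends m integral_unique)
    qed (use ends Omega_less_pi in auto)
    show ?thesis
    proof (rule profile_curve_unique[OF adm ext rad_pos lmin order_refl])
      fix s assume s: "s \<in> {0..L}"
      have "\<omega> - (L - s) / rad = (s - (L - rad * \<omega>)) / rad" using rad_pos by (simp add: field_simps)
      moreover have "(L - s) / rad \<ge> 0" using s rad_pos by simp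
      ultimately show "\<phi> s = profile \<omega> rad (L - rad * \<omega>) s"
        using \<phi>[OF s] Omega_pos by (simp add: profile_def ends)
    qed auto
  next
    case False
    then have m: "m = a" by (simp add: m_def)
    have \<phi>: "\<phi> s = min (\<phi> L) (s / rad)" if "s \<in> {0..L}" for s
    proof (rule arc_segment_rigidity[OF rad_pos L cont mono ends(1) _ lip _ that])
      show "integral {0..L} (\<lambda>u. sin (\<phi> L - \<phi> u)) \<le> rad * (1 - cos (\<phi> L))"
        using bal(2) rad_eqs(1) by (simp add: ends m integral_unique)
    qed (use ends Omega_less_pi in auto)
    show ?thesis
    proof (rule profile_curve_unique[OF adm ext rad_pos order_refl lmin])
      fix s assume s: "s \<in> {0..L}"
      then have "0 \<le> s / rad" using rad_pos by simp
      then show "\<phi> s = profile \<omega> rad 0 s"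
        using \<phi>[OF s] by (simp add: profile_def ends)
    qed auto
  qed
  then show ?thesis by (simp add: cL)
qed

section \<open>Curves made of an arc and a segment\<close>

lemma dir_eq_imp_angle_eq:
  assumes "dir x = dir y" "\<bar>x - y\<bar> < pi"
  shows "x = y"
proof -
  have "cos (x - y) = 1" using dir_inner[of y x] dir_inner[of x x] assms(1) by simp
  then have "cos \<bar>x - y\<bar> = cos 0" by simp
  then have "\<bar>x - y\<bar> = 0" using assms(2) cos_inj_pi[of "\<bar>x - y\<bar>" 0] by simp
  then show ?thesis by simp
qed

lemma admissible_angle_range:
  assumes "admissible_angle L X \<phi>" "0 \<le> s" "s \<le> t" "t \<le> L"
  shows "\<phi> s \<le> \<phi> t" "\<phi> t - \<phi> s < pi"
proof -
  have mono: "mono_on {0..L} \<phi>" and e: "\<phi> 0 = 0" "\<phi> L = \<omega>"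
    using assms(1) by (auto simp: admissible_angle_def)
  have "0 \<le> \<phi> s" "\<phi> t \<le> \<omega>"
    using mono_onD[OF mono, of 0 s] mono_onD[OF mono, of t L] assms e by auto
  then show "\<phi> t - \<phi> s < pi" using Omega_less_pi by simp
  show "\<phi> s \<le> \<phi> t" using mono_onD[OF mono, of s t] assms by auto
qed

text \<open>Both \<open>\<phi> s - \<phi> u\<close> and \<open>(s - u) / R\<close> lie in \<open>{0..pi}\<close>, where the cosine is injective; monotonicity
  of \<open>\<phi>\<close> excludes clockwise arcs.\<close>

lemma angle_on_arc:
  assumes adm: "admissible_angle L X \<phi>" and R: "0 < R" and arc: "arc_on R u v X"
    and uv: "0 \<le> u" "u < v" "v \<le> L" "v - u < R * pi" and s: "s \<in> {u..v}"
  shows "\<phi> s = \<phi> u + (s - u) / R"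
proof -
  have "dir (\<phi> u) \<bullet> dir (\<phi> s) = cos ((s - u) / R)"
  proof (rule arc_on_tangent_inner[OF R arc uv(2)])
    show "(X has_vector_derivative dir (\<phi> s)) (at s within {u..v})" if "s \<in> {u..v}" for s
      by (rule has_vector_derivative_within_subset[of X _ _ "{0..L}"])
         (use adm uv that in \<open>auto simp: admissible_angle_def\<close>)
  qed (use s uv in auto)
  then have "cos (\<phi> s - \<phi> u) = cos ((s - u) / R)" by (simp add: dir_inner)
  moreover have "0 \<le> \<phi> s - \<phi> u" "\<phi> s - \<phi> u \<le> pi"
    using admissible_angle_range[OF adm, of u s] s uv by auto
  moreover have "0 \<le> (s - u) / R" "(s - u) / R \<le> pi"
    using s uv(4) R by (auto simp: field_simps)
  ultimately have "\<phi> s - \<phi> u = (s - u) / R" by (simp only: cos_inj_pi)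
  then show ?thesis by simp
qed

lemma angle_on_segment:
  assumes adm: "admissible_angle L X \<phi>" and seg: "segment_on u v X"
    and uv: "0 \<le> u" "u < v" "v \<le> L" and s: "s \<in> {u..v}"
  shows "\<phi> s = \<phi> u"
proof (rule dir_eq_imp_angle_eq)
  show "dir (\<phi> s) = dir (\<phi> u)"
  proof (rule segment_on_tangent_const[OF seg uv(2), of "\<lambda>s. dir (\<phi> s)"])
    show "(X has_vector_derivative dir (\<phi> s)) (at s within {u..v})" if "s \<in> {u..v}" for s
      by (rule has_vector_derivative_within_subset[of X _ _ "{0..L}"])
         (use adm uv that in \<open>auto simp: admissible_angle_def\<close>)
  qed (use s uv in auto)
  show "\<bar>\<phi> s - \<phi> u\<bar> < pi"
    using admissible_angle_range[OF adm, of u s] s uv by auto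
qed

lemma arc_and_segment_imp_arcseg:
  assumes c: "c \<in> curves P A B" and shape: "is_single_arc c \<or> is_arc_and_segment c"
  shows "c = arcseg"
proof -
  obtain L X where cL: "c = (L, X)" by (cases c)
  from c obtain \<phi> where ext: "X \<in> extensional {0..L}" and adm: "admissible_angle L X \<phi>"
    unfolding cL curves_iff by blast
  then have L: "0 < L" and ends: "\<phi> 0 = 0" "\<phi> L = \<omega>"
    by (auto simp: admissible_angle_def)
  note unique = profile_curve_unique[OF adm ext]
  from shape consider
      (arc) R where "0 < R" "L < R * pi" "arc_on R 0 L X"
    | (arc_seg) R n where "0 < R" "0 < n" "n < L" "n < R * pi" "arc_on R 0 n X" "segment_on n L X"
    | (seg_arc) R n where "0 < R" "0 < n" "n < L" "L - n < R * pi" "segment_on 0 n X" "arc_on R n L X"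
    unfolding is_single_arc_def is_arc_and_segment_def cL by auto
  then have "(L, X) = arcseg"
  proof cases
    case arc
    have \<phi>: "\<phi> s = s / R" if "s \<in> {0..L}" for s
      using angle_on_arc[OF adm arc(1,3) _ L _ _ that] arc(2) ends by simp
    from \<phi>[of L] have "L = R * \<omega>" using L arc(1) ends by (simp add: field_simps)
    show ?thesis
    proof (rule unique[OF arc(1), of 0 0])
      fix s assume s: "s \<in> {0..L}"
      have "s / R \<le> \<omega>" "0 \<le> s / R" using s arc(1) \<open>L = R * \<omega>\<close> by (auto simp: field_simps)
      then show "\<phi> s = profile \<omega> R 0 s" using \<phi>[OF s] by (simp add: profile_def)
    qed (use \<open>L = R * \<omega>\<close> in auto)
  next
    case arc_seg
    have \<phi>: "\<phi> s = s / R" if "s \<in> {0..n}" for s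
      using angle_on_arc[OF adm arc_seg(1,5) _ arc_seg(2) _ _ that] arc_seg(3,4) ends by simp
    have \<phi>': "\<phi> s = \<omega>" if "s \<in> {n..L}" for s
      using angle_on_segment[OF adm arc_seg(6) _ arc_seg(3) _ that] angle_on_segment[OF adm arc_seg(6) _ arc_seg(3), of L]
        arc_seg(2,3) ends by simp
    have n: "n = R * \<omega>" using \<phi>[of n] \<phi>'[of n] arc_seg(1,2,3) by (simp add: field_simps)
    show ?thesis
    proof (rule unique[OF arc_seg(1), of 0 "L - n"])
      fix s assume s: "s \<in> {0..L}"
      show "\<phi> s = profile \<omega> R 0 s"
      proof (cases "s \<le> n")
        case True
        then have "s / R \<le> \<omega>" "0 \<le> s / R" using s arc_seg(1) n by (auto simp: field_simps)
        then show ?thesis using \<phi>[of s] s True by (simp add: profile_def)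
      next
        case False
        then have "\<omega> \<le> s / R" using arc_seg(1) n by (auto simp: field_simps)
        then show ?thesis using \<phi>'[of s] s False Omega_pos by (simp add: profile_def)
      qed
    qed (use n arc_seg(3) in auto)
  next
    case seg_arc
    have \<phi>: "\<phi> s = 0" if "s \<in> {0..n}" for s
      using angle_on_segment[OF adm seg_arc(5) _ seg_arc(2) _ that] seg_arc(3) ends by simp
    have \<phi>': "\<phi> s = (s - n) / R" if "s \<in> {n..L}" for s
      using angle_on_arc[OF adm seg_arc(1,6) _ seg_arc(3) _ _ that] \<phi>[of n] seg_arc(2,4) by simp
    have n: "L - n = R * \<omega>" using \<phi>'[of L] ends seg_arc(1,3) by (simp add: field_simps)
    show ?thesis
    proof (rule unique[OF seg_arc(1), of n 0])
      fix s assume s: "s \<in> {0..L}"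
      show "\<phi> s = profile \<omega> R n s"
      proof (cases "s \<le> n")
        case True
        then have "(s - n) / R \<le> 0" using seg_arc(1) by (simp add: divide_le_0_iff)
        then show ?thesis using \<phi>[of s] s True Omega_pos by (simp add: profile_def)
      next
        case False
        then have "(s - n) / R \<le> \<omega>" "0 \<le> (s - n) / R" using s seg_arc(1) n by (auto simp: field_simps)
        then show ?thesis using \<phi>'[of s] s False by (simp add: profile_def)
      qed
    qed (use n seg_arc(2) in auto)
  qed
  then show ?thesis by (simp add: cL)
qed

lemma arcseg_arc_on:
  assumes u: "u = a - m" and v: "v = a - m + rad * \<omega>"
  shows "arc_on rad u v (restrict X0 {0..len})"
proof -
  obtain \<theta> where \<theta>: "alpha P A = vector [cos \<theta>, sin \<theta>]"
    by (rule unit_vector_polar[OF norm_alpha])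
  \<comment> \<open>Seen from its centre, the point of the arc with tangent angle \<open>t\<close> is a quarter turn behind its
    tangent.\<close>
  have circ: "vector [cos (\<theta> - pi / 2 + t), sin (\<theta> - pi / 2 + t)] = sin t *\<^sub>R alpha P A - cos t *\<^sub>R \<kappa>" for t
  proof -
    have shift: "\<theta> - pi / 2 + t = (\<theta> + t) - pi / 2" by simp
    show ?thesis
      unfolding shift cos_diff sin_diff
      by (simp add: \<theta> rot90_def vec_eq_iff forall_2 cos_add sin_add)
  qed
  define p where "p = X0 u + rad *\<^sub>R \<kappa>"
  have uv: "0 \<le> u" "u < v" "v \<le> len"
    using m_bounds mult_pos_pos[OF rad_pos Omega_pos] by (auto simp: u v len_def)
  have "X0 s = p + rad *\<^sub>R (sin ((s - u) / rad) *\<^sub>R alpha P A - cos ((s - u) / rad) *\<^sub>R \<kappa>)" if "s \<in> {u..v}" for s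
  proof (rule eq_on_interval_if_same_derivative[OF _ _ _ that])
    fix s assume s: "s \<in> {u..v}"
    show "(X0 has_vector_derivative dir (ang s)) (at s within {u..v})"
      by (rule has_vector_derivative_within_subset[OF X0_deriv]) (use s uv in auto)
    have "0 \<le> (s - u) / rad" "(s - u) / rad \<le> \<omega>" using s rad_pos by (auto simp: u v field_simps)
    then have as: "ang s = (s - u) / rad" by (simp add: ang_def profile_def u)
    have "((\<lambda>s. (s - u) / rad) has_vector_derivative 1 / rad) (at s within {u..v})"
      using rad_pos by (auto intro!: derivative_eq_intros simp: has_real_derivative_iff_has_vector_derivative[symmetric])
    from vector_diff_chain_within[OF this has_vector_derivative_at_within[OF dir_primitive]]
    have "((\<lambda>s. sin ((s - u) / rad) *\<^sub>R alpha P A - cos ((s - u) / rad) *\<^sub>R \<kappa>)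
        has_vector_derivative (1 / rad) *\<^sub>R dir (ang s)) (at s within {u..v})"
      by (simp add: o_def as)
    from has_vector_derivative_add[OF has_vector_derivative_const has_vector_derivative_scaleR[OF DERIV_const this], of p rad]
    show "((\<lambda>s. p + rad *\<^sub>R (sin ((s - u) / rad) *\<^sub>R alpha P A - cos ((s - u) / rad) *\<^sub>R \<kappa>))
        has_vector_derivative dir (ang s)) (at s within {u..v})"
      using rad_pos by simp
  qed (simp add: p_def)
  then show ?thesis
    unfolding arc_on_def using uv
    by (intro exI[of _ p] exI[of _ "\<theta> - pi / 2"] exI[of _ 1]) (simp add: circ)
qed

lemma arcseg_segment_on:
  assumes uv: "0 \<le> u" "u < v" "v \<le> len" and const: "\<And>s. s \<in> {u..v} \<Longrightarrow> ang s = t"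
  shows "segment_on u v (restrict X0 {0..len})"
proof -
  define p where "p = X0 u"
  have "X0 s = p + (s - u) *\<^sub>R dir t" if "s \<in> {u..v}" for s
  proof (rule eq_on_interval_if_same_derivative[OF _ _ _ that])
    fix s assume s: "s \<in> {u..v}"
    show "(X0 has_vector_derivative dir t) (at s within {u..v})"
      by (rule has_vector_derivative_within_subset[OF X0_deriv[of s, unfolded const[OF s]]]) (use s uv in auto)
    show "((\<lambda>s. p + (s - u) *\<^sub>R dir t) has_vector_derivative dir t) (at s within {u..v})"
      by (auto intro!: derivative_eq_intros)
  qed (simp add: p_def)
  then show ?thesis
    unfolding segment_on_def using uv
    by (intro exI[of _ p] exI[of _ "dir t"]) (simp add: norm_dir)
qed

lemma is_J_arcseg: "is_J P A B arcseg"
proof -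
  have r: "0 < rad * \<omega>" "rad * \<omega> < rad * pi"
    using rad_pos Omega_pos Omega_less_pi by auto
  consider "a = b" | "a < b" | "b < a" by linarith
  then have "if a = b then is_single_arc arcseg else is_arc_and_segment arcseg"
  proof cases
    case 1
    then have m: "m = a" "m = b" by (auto simp: m_def)
    have "arc_on rad 0 len (restrict X0 {0..len})"
      by (rule arcseg_arc_on) (use m in \<open>simp_all add: len_def\<close>)
    then have "is_single_arc arcseg"
      unfolding is_single_arc_def arcseg_def using len_pos rad_pos r m
      by (intro exI[of _ rad]) (simp add: len_def)
    with 1 show ?thesis by simp
  next
    case 2
    then have m: "m = a" by (auto simp: m_def)
    have "arc_on rad 0 (rad * \<omega>) (restrict X0 {0..len})"
      by (rule arcseg_arc_on) (use m in \<open>simp_all add: len_def\<close>)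
    moreover have "segment_on (rad * \<omega>) len (restrict X0 {0..len})"
    proof (rule arcseg_segment_on)
      fix s assume "s \<in> {rad * \<omega>..len}"
      then have "\<omega> \<le> s / rad" using rad_pos by (simp add: field_simps)
      then show "ang s = \<omega>" using Omega_pos m by (simp add: ang_def profile_def)
    qed (use 2 m r in \<open>auto simp: len_def\<close>)
    moreover have "rad * \<omega> < len" using 2 m by (simp add: len_def)
    ultimately have "is_arc_and_segment arcseg"
      unfolding is_arc_and_segment_def arcseg_def using rad_pos r
      by (intro exI[of _ rad] conjI exI[of _ "rad * \<omega>"]) auto
    with 2 show ?thesis by simp
  next
    case 3
    then have m: "m = b" by (auto simp: m_def)
    have "arc_on rad (a - b) len (restrict X0 {0..len})"
      by (rule arcseg_arc_on) (use m in \<open>simp_all add: len_def\<close>)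
    moreover have "segment_on 0 (a - b) (restrict X0 {0..len})"
    proof (rule arcseg_segment_on)
      fix s assume "s \<in> {0..a - b}"
      then have "(s - (a - b)) / rad \<le> 0" using rad_pos by (simp add: divide_le_0_iff)
      then show "ang s = 0" using Omega_pos m by (simp add: ang_def profile_def)
    qed (use 3 m r in \<open>auto simp: len_def\<close>)
    moreover have "a - b < len" "len - (a - b) < rad * pi" using m r by (auto simp: len_def)
    ultimately have "is_arc_and_segment arcseg"
      unfolding is_arc_and_segment_def arcseg_def using rad_pos 3
      by (intro exI[of _ rad] conjI exI[of _ "a - b"]) auto
    with 3 show ?thesis by simp
  qed
  with arcseg_in_curves show ?thesis by (simp add: is_J_def)
qed

lemma is_J_iff: "is_J P A B c \<longleftrightarrow> c = arcseg"
proof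
  assume "is_J P A B c"
  then show "c = arcseg"
    unfolding is_J_def by (intro arc_and_segment_imp_arcseg) (auto split: if_splits)
qed (use is_J_arcseg in simp)

lemma J_eq: "J P A B = arcseg"
  by (simp add: J_def is_J_iff)

section \<open>Minimizers of the maximal curvature\<close>

lemma arg_min_max_curvature_iff:
  "is_arg_min max_curvature (\<lambda>Z. Z \<in> curves P A B) X \<longleftrightarrow> X = arcseg"
proof
  assume X: "is_arg_min max_curvature (\<lambda>Z. Z \<in> curves P A B) X"
  then have "\<not> max_curvature arcseg < max_curvature X"
    using arcseg_in_curves unfolding is_arg_min_def by blast
  then have "max_curvature X \<le> max_curvature arcseg" by (simp add: not_less)
  then show "X = arcseg"
    using X arcseg_W2_curvature(2) by (intro small_curvature_imp_arcseg) (auto simp: is_arg_min_def)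
next
  assume "X = arcseg"
  moreover have "\<not> max_curvature Z < max_curvature arcseg" if Z: "Z \<in> curves P A B" for Z
  proof
    assume less: "max_curvature Z < max_curvature arcseg"
    then have "max_curvature Z \<le> ereal (1 / rad)" using arcseg_W2_curvature(2) by (rule order_trans[OF less_imp_le])
    then have "Z = arcseg" by (rule small_curvature_imp_arcseg[OF Z])
    with less show False by simp
  qed
  ultimately show "is_arg_min max_curvature (\<lambda>Z. Z \<in> curves P A B) X"
    using arcseg_in_curves by (auto simp: is_arg_min_def)
qed

end

theorem mainTheorem1:
  fixes P A B :: "real^2"
  assumes "P \<noteq> A" and "P \<noteq> B" and "A \<noteq> B"
    and "0 < Omega P A B" and "Omega P A B < pi"
  shows "(\<exists>!c. is_J P A B c) \<and>
    (\<forall>X. is_arg_min max_curvature (\<lambda>Z. Z \<in> curves P A B) X \<longleftrightarrow> X = J P A B)"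
proof -
  interpret corner P A B by (rule corner.intro[OF assms(1,2,4,5)])
  have "\<exists>!c. is_J P A B c"
    by (rule ex1I[of _ arcseg]) (simp_all add: is_J_iff)
  moreover have "is_arg_min max_curvature (\<lambda>Z. Z \<in> curves P A B) X \<longleftrightarrow> X = J P A B" for X
    unfolding J_eq by (rule arg_min_max_curvature_iff)
  ultimately show ?thesis by blast
qed

end
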